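(* Let $G$ be a finite group and let $N$ be a characteristic subgroup of $G$. Then: (1) $\mathrm{mao}_{\mathrm{rel}}(G/N)\geq \mathrm{mao}_{\mathrm{rel}}(G)$. (2) $\mathrm{maffo}_{\mathrm{rel}}(G/N)\geq \mathrm{maffo}_{\mathrm{rel}}(G)$.
   Context: For a finite group $G$, $\mathrm{mao}(G)$ denotes the maximum order of an automorphism of $G$. For $x\in G$ and $\alpha\in\mathrm{Aut}(G)$, let $\mathrm{A}_{x,\alpha}:G\rightarrow G$ denote the bijective affine map $g\mapsto x\alpha(g)$; $\mathrm{maffo}(G)$ denotes the maximum order of a permutation of $G$ of the form $\mathrm{A}_{x,\alpha}$ with $x\in G$, $\alpha\in\mathrm{Aut}(G)$ (equivalently, the maximum element order in the holomorph $\mathrm{Hol}(G)=G\rtimes\mathrm{Aut}(G)$). Set $\mathrm{mao}_{\mathrm{rel}}(G):=\mathrm{mao}(G)/|G|$ and $\mathrm{maffo}_{\mathrm{rel}}(G):=\mathrm{maffo}(G)/|G|$. *)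

theory Defs
  imports Complex_Main "HOL-Algebra.Algebra"
begin

definition characteristic_subgroup :: "'a set \<Rightarrow> ('a, 'b) monoid_scheme \<Rightarrow> bool"
  where "characteristic_subgroup N G \<longleftrightarrow> subgroup N G \<and> (\<forall>\<alpha>\<in>auto G. \<alpha> ` N = N)"

text \<open>Restricting to the carrier makes the affine maps elements of the library's symmetric
  group \<^const>\<open>BijGroup\<close>, whose members are extensional functions.\<close>

definition affine_map :: "('a, 'b) monoid_scheme \<Rightarrow> 'a \<Rightarrow> ('a \<Rightarrow> 'a) \<Rightarrow> 'a \<Rightarrow> 'a"
  where "affine_map G x \<alpha> = (\<lambda>g\<in>carrier G. x \<otimes>\<^bsub>G\<^esub> \<alpha> g)"

text \<open>For a finite group, both maxima below range over finite nonempty sets; otherwise the values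
  are not meaningful.\<close>

definition mao :: "('a, 'b) monoid_scheme \<Rightarrow> nat"
  where "mao G = Max {group.ord (AutoGroup G) \<alpha> | \<alpha>. \<alpha> \<in> auto G}"

definition maffo :: "('a, 'b) monoid_scheme \<Rightarrow> nat"
  where "maffo G =
    Max {group.ord (BijGroup (carrier G)) (affine_map G x \<alpha>) | x \<alpha>. x \<in> carrier G \<and> \<alpha> \<in> auto G}"

definition mao_rel :: "('a, 'b) monoid_scheme \<Rightarrow> real"
  where "mao_rel G = real (mao G) / real (order G)"

definition maffo_rel :: "('a, 'b) monoid_scheme \<Rightarrow> real"
  where "maffo_rel G = real (maffo G) / real (order G)"

lemma (in group) affine_map_in_Bij:
  assumes x: "x \<in> carrier G" and \<alpha>: "\<alpha> \<in> auto G"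
  shows "affine_map G x \<alpha> \<in> carrier (BijGroup (carrier G))"
proof -
  have bij: "bij_betw \<alpha> (carrier G) (carrier G)"
    using \<alpha> by (simp add: auto_def Bij_def)
  have "bij_betw (\<lambda>g. x \<otimes> g) (carrier G) (carrier G)"
    by (rule bij_betw_byWitness[where f' = "\<lambda>g. inv x \<otimes> g"])
      (use x in \<open>auto simp: m_assoc[symmetric]\<close>)
  from bij_betw_trans[OF bij this]
  have "bij_betw (affine_map G x \<alpha>) (carrier G) (carrier G)"
    by (subst bij_betw_cong[where g = "(\<lambda>g. x \<otimes> g) \<circ> \<alpha>"]) (auto simp: affine_map_def)
  then show ?thesis
    by (simp add: BijGroup_def Bij_def affine_map_def)
qed

end

theory Submission
  imports Defs "HOL-Number_Theory.Cong"
begin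

text \<open>Let \<open>A\<close> be an affine map of \<open>G\<close> and \<open>L\<close> the order of the map it induces on \<open>G/N\<close>. It suffices to
  show that \<open>A\<^sup>L\<close> has order at most \<open>|N|\<close>. More generally, let \<open>b\<close> be an affine map with linear part
  \<open>\<beta>\<close> that preserves every coset of a normal subgroup \<open>N\<close>; by induction on \<open>|N|\<close>, after dividing by a
  maximal proper \<open>\<beta>\<close>-invariant normal subgroup inside \<open>N\<close>, the subgroup \<open>M\<close> in place of \<open>N\<close> is minimal
  among the \<open>\<beta>\<close>-invariant normal subgroups of \<open>G\<close>.

  If \<open>M\<close> is abelian, either \<open>\<beta>\<close> is trivial on \<open>M\<close>, and \<open>b\<close> acts on each coset as a translation, or
  every power of \<open>\<beta>\<close> that is nontrivial on \<open>M\<close> fixes only \<open>1\<close> there, and the order of \<open>b\<close>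
  is that of \<open>\<beta>\<close> on \<open>M\<close>, hence the length of an orbit in \<open>M\<close>. If \<open>M\<close> is nonabelian, it has no
  nontrivial normal \<open>p\<close>-subgroup, and the order of \<open>b\<close> divides the least common multiple of the
  orders of two automorphisms of \<open>M\<close> that differ by an inner one. By Zenkov's theorem on
  intersections of abelian subgroups, the cyclic group generated by an automorphism meets
  some conjugate of itself trivially, which bounds this least common multiple by \<open>|M|\<close>.\<close>

section \<open>Conjugation and \<open>p\<close>-subgroups\<close>

text \<open>The proof tracks a period l, that is l > 0 with b^l the identity, rather than the order
  of b: periods multiply along a chain of subgroups as cardinalities do, and since |G| = |G/N| |N|,
  a period of at most L |N| is enough.

  The two automorphisms of the nonabelian case record what b does to a factor from M on either side:
  b(g n) = b(g) \<beta>(n) and b(n g) = \<kappa>(n) b(g), where \<kappa> is \<beta> followed by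
  conjugation by b(1). If \<beta>^l and \<kappa>^l are trivial on M, comparing the two formulas
  shows that inv g b^l(g) commutes with M, hence is 1 because M has trivial centre.

  The obstacle is that l is a least common multiple, so bounding each order by |M| is too weak. As
  \<beta> and \<kappa> agree modulo inner automorphisms, they have the same order s there; if their
  orders are s t and s u, the lcm is at most s t u. So the bound to aim for is s t^2 \<le> |M|: the
  order of an automorphism times the number of its powers that are inner. This product form is what
  a trivially intersecting conjugate provides.\<close>

hide_const (open) Divisibility.prime

text \<open>Phrased through element orders so that subgroups, products and unions can be treated
  without counting; \<open>p_subgroup_card\<close> recovers the order as a power of p.\<close>

definition (in group) p_subgroup :: "nat \<Rightarrow> 'a set \<Rightarrow> bool"
  where "p_subgroup p P \<longleftrightarrow> subgroup P G \<and> (\<forall>x\<in>P. \<exists>k::nat. x [^] (p ^ k) = \<one>)"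

definition (in group) conjg :: "'a \<Rightarrow> 'a \<Rightarrow> 'a"
  where "conjg g x = g \<otimes> x \<otimes> inv g"

context group
begin

lemma conjg_closed [simp]: "\<lbrakk>g \<in> carrier G; x \<in> carrier G\<rbrakk> \<Longrightarrow> conjg g x \<in> carrier G"
  by (simp add: conjg_def)

lemma conjg_conj: "\<lbrakk>g \<in> carrier G; h \<in> carrier G; x \<in> carrier G\<rbrakk> \<Longrightarrow> conjg g (conjg h x) = conjg (g \<otimes> h) x"
  by (simp add: conjg_def inv_mult_group m_assoc)

lemma conjg_one [simp]: "x \<in> carrier G \<Longrightarrow> conjg \<one> x = x"
  by (simp add: conjg_def)

lemma conjg_one_right [simp]: "g \<in> carrier G \<Longrightarrow> conjg g \<one> = \<one>"
  by (simp add: conjg_def)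

lemma conjg_inv_conj [simp]: "\<lbrakk>g \<in> carrier G; x \<in> carrier G\<rbrakk> \<Longrightarrow> conjg (inv g) (conjg g x) = x"
  and conjg_conj_inv [simp]: "\<lbrakk>g \<in> carrier G; x \<in> carrier G\<rbrakk> \<Longrightarrow> conjg g (conjg (inv g) x) = x"
  by (simp_all add: conjg_conj)

lemma conjg_mult: "\<lbrakk>g \<in> carrier G; x \<in> carrier G; y \<in> carrier G\<rbrakk> \<Longrightarrow> conjg g (x \<otimes> y) = conjg g x \<otimes> conjg g y"
proof -
  assume a: "g \<in> carrier G" "x \<in> carrier G" "y \<in> carrier G"
  then have "inv g \<otimes> (g \<otimes> (y \<otimes> inv g)) = y \<otimes> inv g"
    by (simp flip: m_assoc)
  with a show ?thesis
    by (simp add: conjg_def m_assoc)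
qed

lemma conjg_inv: "\<lbrakk>g \<in> carrier G; x \<in> carrier G\<rbrakk> \<Longrightarrow> conjg g (inv x) = inv (conjg g x)"
  by (simp add: conjg_def inv_mult_group m_assoc)

lemma conjg_in_hom: "g \<in> carrier G \<Longrightarrow> conjg g \<in> hom G G"
  by (auto simp: hom_def conjg_mult)

lemma conjg_pow: "\<lbrakk>g \<in> carrier G; x \<in> carrier G\<rbrakk> \<Longrightarrow> conjg g (x [^] (n::nat)) = conjg g x [^] n"
  by (induction n) (auto simp: conjg_mult)

lemma conjg_eq_self_iff: "\<lbrakk>g \<in> carrier G; x \<in> carrier G\<rbrakk> \<Longrightarrow> conjg g x = x \<longleftrightarrow> g \<otimes> x = x \<otimes> g"
  unfolding conjg_def
  by (metis inv_closed inv_solve_right m_closed)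

lemma conjg_inj_on: "\<lbrakk>g \<in> carrier G; S \<subseteq> carrier G\<rbrakk> \<Longrightarrow> inj_on (conjg g) S"
  by (rule inj_on_inverseI[where g = "conjg (inv g)"]) auto

lemma conjg_image_conj:
  "\<lbrakk>g \<in> carrier G; h \<in> carrier G; S \<subseteq> carrier G\<rbrakk> \<Longrightarrow> conjg g ` conjg h ` S = conjg (g \<otimes> h) ` S"
  by (auto simp: image_image conjg_conj subset_iff intro!: image_cong)

lemma conjg_image_one: "S \<subseteq> carrier G \<Longrightarrow> conjg \<one> ` S = S"
  by (auto simp: subset_iff image_iff)

lemma subgroup_conjg_closed: "\<lbrakk>subgroup H G; g \<in> H; x \<in> H\<rbrakk> \<Longrightarrow> conjg g x \<in> H"
  by (simp add: conjg_def subgroup.m_closed subgroup.m_inv_closed)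

lemma subgroup_conjg_image: "\<lbrakk>subgroup H G; g \<in> carrier G\<rbrakk> \<Longrightarrow> subgroup (conjg g ` H) G"
proof -
  assume a: "subgroup H G" "g \<in> carrier G"
  then interpret group_hom G G "conjg g" by unfold_locales (simp add: conjg_in_hom)
  show ?thesis using a subgroup_img_is_subgroup by simp
qed

lemma conjg_image_subset_imp_eq:
  assumes g: "g \<in> carrier G" and S: "finite S" "S \<subseteq> carrier G" and sub: "conjg g ` S \<subseteq> S"
  shows "conjg g ` S = S"
  by (rule card_subset_eq[OF S(1) sub]) (simp add: card_image conjg_inj_on g S)

lemma subgroup_normalizer:
  assumes S: "S \<subseteq> carrier G" "finite S"
  shows "subgroup {g \<in> carrier G. conjg g ` S = S} G"
proof (rule subgroupI)
  show "{g \<in> carrier G. conjg g ` S = S} \<noteq> {}"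
    using conjg_image_one[OF S(1)] by blast
next
  fix a assume a: "a \<in> {g \<in> carrier G. conjg g ` S = S}"
  then have "conjg (inv a) ` S = conjg (inv a) ` conjg a ` S" by simp
  also have "\<dots> = S" using a S conjg_image_conj[of "inv a" a S] by (simp add: conjg_image_one)
  finally show "inv a \<in> {g \<in> carrier G. conjg g ` S = S}" using a by simp
next
  fix a b assume "a \<in> {g \<in> carrier G. conjg g ` S = S}" "b \<in> {g \<in> carrier G. conjg g ` S = S}"
  then show "a \<otimes> b \<in> {g \<in> carrier G. conjg g ` S = S}"
    using S conjg_image_conj[of a b S] by simp
qed auto

lemma p_subgroup_subset: "\<lbrakk>p_subgroup p P; subgroup Q G; Q \<subseteq> P\<rbrakk> \<Longrightarrow> p_subgroup p Q"
  by (auto simp: p_subgroup_def)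

lemma p_subgroup_carrier: "p_subgroup p P \<Longrightarrow> P \<subseteq> carrier G"
  by (auto simp: p_subgroup_def dest: subgroup.subset)

lemma p_subgroup_conjg: "\<lbrakk>p_subgroup p P; g \<in> carrier G\<rbrakk> \<Longrightarrow> p_subgroup p (conjg g ` P)"
  unfolding p_subgroup_def
proof safe
  fix x assume P: "subgroup P G" "\<forall>x\<in>P. \<exists>k::nat. x [^] (p ^ k) = \<one>" and g: "g \<in> carrier G" and x: "x \<in> P"
  then obtain k :: nat where k: "x [^] (p ^ k) = \<one>" by auto
  have "x \<in> carrier G" using P x subgroup.subset by blast
  then have "conjg g x [^] (p ^ k) = conjg g \<one>"
    using g k by (simp flip: conjg_pow)
  then show "\<exists>k::nat. conjg g x [^] (p ^ k) = \<one>" using g by auto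
qed (rule subgroup_conjg_image)

lemma p_subgroup_generate_singleton:
  assumes x: "x \<in> carrier G" and k: "x [^] (p ^ k :: nat) = \<one>"
  shows "p_subgroup p (generate G {x})"
  unfolding p_subgroup_def
proof safe
  show "subgroup (generate G {x}) G" using x by (intro generate_is_subgroup) simp
next
  fix y assume "y \<in> generate G {x}"
  then obtain i :: int where y: "y = x [^] i" using generate_pow[OF x] by auto
  have "y [^] (p ^ k :: nat) = (x [^] (p ^ k :: nat)) [^] i"
    using x by (simp add: y int_pow_pow int_pow_int[symmetric] mult.commute del: int_pow_int)
  then show "\<exists>k::nat. y [^] (p ^ k) = \<one>" using k by (auto intro!: exI[of _ k])
qed

text \<open>Sylow's theorem with exponent 1 is Cauchy's theorem: a prime divisor q of the order
  yields an element of order q, and q then divides a power of p.\<close>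

lemma p_subgroup_card:
  assumes P: "p_subgroup p P" and fin: "finite P" and p: "prime p"
  obtains n where "card P = p ^ n"
proof -
  have sP: "subgroup P G" using P by (simp add: p_subgroup_def)
  then interpret K: group "G\<lparr>carrier := P\<rparr>" by (rule subgroup_imp_group)
  have pos: "card P > 0" using fin sP subgroup.one_closed by (fastforce simp: card_gt_0_iff)
  have "q = p" if q: "prime q" "q dvd card P" for q
  proof -
    obtain m where "card P = q * m" using q by auto
    then have "\<exists>H. subgroup H (G\<lparr>carrier := P\<rparr>) \<and> card H = q ^ 1"
      using q fin by (intro sylow_thm[where m = m]) (auto simp: order_def)
    then obtain H where H: "subgroup H (G\<lparr>carrier := P\<rparr>)" "card H = q" by auto
    then have HG: "subgroup H G" and HP: "H \<subseteq> P"
      using incl_subgroup[OF sP] subgroup.subset by fastforce+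
    have "H \<noteq> {\<one>}" using H(2) q by auto
    then obtain x where x: "x \<in> H" "x \<noteq> \<one>" using HG subgroup.one_closed by blast
    interpret H: group "G\<lparr>carrier := H\<rparr>" using HG by (rule subgroup_imp_group)
    have "x [^]\<^bsub>G\<lparr>carrier := H\<rparr>\<^esub> order (G\<lparr>carrier := H\<rparr>) = \<one>\<^bsub>G\<lparr>carrier := H\<rparr>\<^esub>"
      using x by (intro H.pow_order_eq_1) simp
    then have xq: "x [^] q = \<one>" using H(2) by (simp add: order_def flip: nat_pow_consistent)
    obtain k :: nat where xp: "x [^] (p ^ k) = \<one>" using P x HP by (auto simp: p_subgroup_def)
    have xc: "x \<in> carrier G" using x HG subgroup.subset by blast
    have "ord x dvd q" "ord x dvd p ^ k" using xq xp pow_eq_id[OF xc] by auto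
    moreover have "ord x \<noteq> 1" using x xc ord_eq_1 by auto
    ultimately have "ord x = q" using q(1) by (auto simp: prime_nat_iff)
    with \<open>ord x dvd p ^ k\<close> have "q dvd p" using q(1) prime_dvd_power by blast
    then show "q = p" using q(1) p primes_dvd_imp_eq by blast
  qed
  then have "set_mset (prime_factorization (card P)) \<subseteq> {p}"
    by (auto simp: prime_factors_dvd)
  then have "prime_factorization (card P) = replicate_mset (size (prime_factorization (card P))) p"
    by (rule set_mset_subset_singletonD)
  then have "card P = p ^ size (prime_factorization (card P))"
    using pos prod_mset_prime_factorization_nat[of "card P"]
    by (metis prod_mset_replicate_mset)
  then show ?thesis by (rule that)
qed

end

section \<open>Actions of p-groups and their fixed points\<close>

text \<open>Orbit sizes divide p^n, so an orbit is either a single fixed point or contributes 0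
  modulo p; the congruence is summed orbit by orbit.\<close>

lemma (in group_action) card_fixed_points_cong:
  assumes card: "order G = p ^ n" and p: "prime p" and fin: "finite E"
  shows "[card E = card {x \<in> E. \<forall>g\<in>carrier G. \<phi> g x = x}] (mod p)"
proof -
  let ?F = "{x \<in> E. \<forall>g\<in>carrier G. \<phi> g x = x}"
  interpret group G using group_hom group_hom.axioms(1) by auto
  let ?O = "orbits G E \<phi>"
  have orbs: "orb \<subseteq> E" "finite orb" if "orb \<in> ?O" for orb
    using that orbits_coverture fin by (auto intro: finite_subset)
  have c: "[(\<Sum>x\<in>orb. 1) = (\<Sum>x\<in>orb. if x \<in> ?F then 1 else 0 :: nat)] (mod p)" if o: "orb \<in> ?O" for orb
  proof -
    obtain x where x: "x \<in> E" "orb = orbit G \<phi> x" using o by (auto simp: orbits_def)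
    have "card orb dvd p ^ n"
      using orbit_stabilizer_theorem[OF x(1)] card x by (metis dvd_triv_left)
    then obtain k where k: "card orb = p ^ k" using p by (auto simp: divides_primepow_nat)
    show ?thesis
    proof (cases "k = 0")
      case True
      then have "orb = {x}" using k x orbit_refl by (metis card_1_singletonE power_0 singletonD)
      moreover have "x \<in> ?F" using calculation x by (auto simp: orbit_def)
      ultimately show ?thesis by auto
    next
      case False
      have "y \<notin> ?F" if "y \<in> orb" for y
      proof
        assume y: "y \<in> ?F"
        then have "orbit G \<phi> y = {y}" by (auto simp: orbit_def intro!: exI[of _ \<one>])
        moreover have "orb \<subseteq> orbit G \<phi> y"
          using x y that orbit_trans[of y x] orbit_sym[of x y] orbs[OF o] by blast
        ultimately have "card orb \<le> 1" using card_mono[of "{y}" orb] by auto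
        moreover have "1 < p ^ k" using False p prime_gt_1_nat[of p] by (intro one_less_power) auto
        ultimately show False using k by simp
      qed
      then have "(\<Sum>x\<in>orb. if x \<in> ?F then 1 else 0 :: nat) = 0" by (intro sum.neutral) auto
      then show ?thesis using k False by (simp add: cong_0_iff)
    qed
  qed
  have "card E = (\<Sum>orb\<in>?O. \<Sum>x\<in>orb. 1)" using disjoint_sum[OF fin, of "\<lambda>_. 1 :: nat"] by simp
  also have "[\<dots> = (\<Sum>orb\<in>?O. \<Sum>x\<in>orb. if x \<in> ?F then 1 else 0)] (mod p)" by (intro cong_sum c)
  also have "(\<Sum>orb\<in>?O. \<Sum>x\<in>orb. if x \<in> ?F then 1 else 0) = (\<Sum>x\<in>E. if x \<in> ?F then 1 else 0 :: nat)"
    by (rule disjoint_sum[OF fin])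
  also have "\<dots> = card ?F" using fin by (simp add: sum.If_cases Int_def conj_commute)
  finally show ?thesis .
qed

context group
begin

text \<open>Elements of \<open>BijGroup E\<close> are extensional, hence the restriction.
  Bijectivity comes from the action of \<open>inv g\<close>.\<close>

lemma group_action_restrictI:
  assumes closed: "\<And>g x. \<lbrakk>g \<in> carrier G; x \<in> E\<rbrakk> \<Longrightarrow> f g x \<in> E"
    and mult: "\<And>g h x. \<lbrakk>g \<in> carrier G; h \<in> carrier G; x \<in> E\<rbrakk> \<Longrightarrow> f (g \<otimes> h) x = f g (f h x)"
    and one: "\<And>x. x \<in> E \<Longrightarrow> f \<one> x = x"
  shows "group_action G E (\<lambda>g. restrict (f g) E)"
proof -
  interpret B: group "BijGroup E" by (rule group_BijGroup)
  have inv1: "f (inv g) (f g x) = x" "f g (f (inv g) x) = x" if "g \<in> carrier G" "x \<in> E" for g x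

    using that mult[of "inv g" g x] mult[of g "inv g" x] by (simp_all add: one)
  have bij: "restrict (f g) E \<in> Bij E" if "g \<in> carrier G" for g
  proof -
    have "bij_betw (f g) E E"
      by (rule bij_betw_byWitness[where f' = "f (inv g)"]) (use that in \<open>auto simp: inv1 closed\<close>)
    then show ?thesis by (simp add: Bij_def)
  qed
  show ?thesis
  proof (unfold_locales, rule homI)
    fix g h assume "g \<in> carrier G" "h \<in> carrier G"
    then show "restrict (f (g \<otimes> h)) E = restrict (f g) E \<otimes>\<^bsub>BijGroup E\<^esub> restrict (f h) E"
      by (auto simp: BijGroup_def bij compose_def closed mult intro!: restrict_ext)
  qed (simp add: BijGroup_def bij)
qed

text \<open>Under conjugation of P on itself the fixed points are the centre. Their number is
  divisible by p and positive because of \<one>, so it exceeds 1.\<close>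

lemma p_subgroup_center:
  assumes P: "p_subgroup p P" and fin: "finite P" and p: "prime p" and ne: "P \<noteq> {\<one>}"
  obtains z where "z \<in> P" "z \<noteq> \<one>" "\<And>x. x \<in> P \<Longrightarrow> x \<otimes> z = z \<otimes> x"
proof -
  have sP: "subgroup P G" and Pc: "P \<subseteq> carrier G"
    using P by (auto simp: p_subgroup_def dest: subgroup.subset)
  let ?K = "G\<lparr>carrier := P\<rparr>"
  interpret K: group ?K using sP by (rule subgroup_imp_group)
  interpret A: group_action ?K P "\<lambda>g. restrict (conjg g) P"
    by (rule K.group_action_restrictI) (use sP Pc in \<open>auto simp: subgroup_conjg_closed conjg_conj subset_iff\<close>)
  obtain n where n: "card P = p ^ n" using p_subgroup_card[OF P fin p] .
  define F where "F = {x \<in> P. \<forall>g\<in>carrier ?K. restrict (conjg g) P x = x}"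
  have cong: "[card P = card F] (mod p)"
    unfolding F_def by (rule A.card_fixed_points_cong[OF _ p fin]) (simp add: order_def n)
  have one: "\<one> \<in> F" using sP Pc by (auto simp: F_def subset_iff dest: subgroup.one_closed)
  have "\<one> \<in> P" using sP by (rule subgroup.one_closed)
  have "n \<noteq> 0"
  proof
    assume "n = 0"
    then obtain w where "P = {w}" using n by (auto simp: card_Suc_eq)
    then show False using ne \<open>\<one> \<in> P\<close> by auto
  qed
  then have "p dvd card P" using n by simp
  then have "p dvd card F" using cong_dvd_iff[OF cong] by simp
  moreover have "card F \<noteq> 0" using one fin by (auto simp: F_def)
  ultimately have "card F \<noteq> 1" using p by auto
  then have "F \<noteq> {\<one>}" by auto
  then obtain z where z: "z \<in> F" "z \<noteq> \<one>" using one by blast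
  show ?thesis
  proof (rule that)
    fix x assume "x \<in> P"
    then show "x \<otimes> z = z \<otimes> x" using z Pc by (auto simp: F_def conjg_eq_self_iff subset_iff)
  qed (use z in \<open>auto simp: F_def\<close>)
qed

text \<open>A version for normal subsets U of the fact that normalisers grow in p-groups. Unless P
  normalises J, the set \<Omega> of P-conjugates of J has size a positive power of p. The normaliser
  T of J in P fixes J in \<Omega>, hence also some other conjugate gJ(inv g). As J lies in T, every
  conjugate of an element of J by \<open>inv g\<close> normalises J and stays in U, and one of these
  is outside J.\<close>

lemma p_subgroup_normalizer_grows:
  assumes P: "p_subgroup p P" and fin: "finite P" and p: "prime p"
    and U: "U \<subseteq> P" "\<And>g. g \<in> P \<Longrightarrow> conjg g ` U \<subseteq> U"
    and J: "J \<subset> U" "\<And>g. g \<in> J \<Longrightarrow> conjg g ` J = J"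
  obtains x where "x \<in> U - J" "conjg x ` J = J"
proof (cases "\<forall>g\<in>P. conjg g ` J = J")
  case True
  obtain x where "x \<in> U" "x \<notin> J" using J(1) by blast
  then show ?thesis using that[of x] True U(1) by simp blast
next
  case False
  have sP: "subgroup P G" and Pc: "P \<subseteq> carrier G"
    using P by (auto simp: p_subgroup_def dest: subgroup.subset)
  have JP: "J \<subseteq> P" using U(1) J(1) by blast
  have Jc: "J \<subseteq> carrier G" and finJ: "finite J"
    using JP Pc finite_subset[OF JP fin] by blast+
  define \<Omega> where "\<Omega> = (\<lambda>g. conjg g ` J) ` P"
  define T where "T = P \<inter> {g \<in> carrier G. conjg g ` J = J}"
  have sub: "S \<subseteq> carrier G" if "S \<in> \<Omega>" for S using that Pc Jc by (auto simp: \<Omega>_def subset_iff)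
  have closed: "conjg g ` S \<in> \<Omega>" if gS: "g \<in> P" "S \<in> \<Omega>" for g S
  proof -
    obtain h where h: "h \<in> P" "S = conjg h ` J" using gS(2) by (auto simp: \<Omega>_def)
    have "conjg g ` S = conjg (g \<otimes> h) ` J"
      unfolding h(2) by (rule conjg_image_conj) (use gS h Pc Jc in auto)
    then show ?thesis using gS h sP by (auto simp: \<Omega>_def subgroup.m_closed)
  qed
  have sT: "subgroup T G" unfolding T_def by (intro subgroups_Inter_pair sP subgroup_normalizer Jc finJ)
  have finO: "finite \<Omega>" using fin by (simp add: \<Omega>_def)
  have JO: "J \<in> \<Omega>" unfolding \<Omega>_def
    by (rule image_eqI[of _ _ \<one>]) (use sP Jc in \<open>simp_all add: conjg_image_one subgroup.one_closed\<close>)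
  interpret K: group "G\<lparr>carrier := P\<rparr>" using sP by (rule subgroup_imp_group)
  interpret L: group "G\<lparr>carrier := T\<rparr>" using sT by (rule subgroup_imp_group)
  have mult: "conjg (g \<otimes> h) ` S = conjg g ` conjg h ` S" if "g \<in> P" "h \<in> P" "S \<in> \<Omega>" for g h S
    by (rule conjg_image_conj[symmetric]) (use that Pc sub in auto)
  have one: "conjg \<one> ` S = S" if "S \<in> \<Omega>" for S
    by (rule conjg_image_one) (use that sub in auto)
  have TP: "T \<subseteq> P" by (auto simp: T_def)
  interpret A: group_action "G\<lparr>carrier := P\<rparr>" \<Omega> "\<lambda>g. restrict (\<lambda>S. conjg g ` S) \<Omega>"
    by (rule K.group_action_restrictI) (simp_all add: closed mult one)
  interpret B: group_action "G\<lparr>carrier := T\<rparr>" \<Omega> "\<lambda>g. restrict (\<lambda>S. conjg g ` S) \<Omega>"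
    by (rule L.group_action_restrictI) (use TP in \<open>simp_all add: closed mult one subset_iff\<close>)
  obtain n where n: "card P = p ^ n" using p_subgroup_card[OF P fin p] .
  have "orbit (G\<lparr>carrier := P\<rparr>) (\<lambda>g. restrict (\<lambda>S. conjg g ` S) \<Omega>) J = \<Omega>"
    using JO unfolding orbit_def by (auto simp: \<Omega>_def)
  then have "card \<Omega> dvd p ^ n"
    using A.orbit_stabilizer_theorem[OF JO] n by (simp add: order_def) (metis dvd_triv_left)
  then obtain k where k: "card \<Omega> = p ^ k" using p by (auto simp: divides_primepow_nat)
  have "k \<noteq> 0"
  proof
    assume "k = 0"
    then obtain w where "\<Omega> = {w}" using k by (auto simp: card_Suc_eq)
    then have "\<Omega> = {J}" using JO by auto
    moreover have "conjg g ` J \<in> \<Omega>" if "g \<in> P" for g unfolding \<Omega>_def using that by (rule imageI)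
    ultimately show False using False by blast
  qed
  have "p_subgroup p T" using p_subgroup_subset[OF P sT] by (simp add: T_def)
  moreover have "finite T" using TP fin by (rule finite_subset)
  ultimately obtain m where m: "card T = p ^ m" using p_subgroup_card[OF _ _ p] by blast
  define F where "F = {S \<in> \<Omega>. \<forall>g\<in>carrier (G\<lparr>carrier := T\<rparr>). restrict (\<lambda>S. conjg g ` S) \<Omega> S = S}"
  have cong: "[card \<Omega> = card F] (mod p)"
    unfolding F_def by (rule B.card_fixed_points_cong[OF _ p finO]) (simp add: order_def m)
  have "p dvd card \<Omega>" using k \<open>k \<noteq> 0\<close> by simp
  then have "p dvd card F" using cong_dvd_iff[OF cong] by simp
  have JF: "J \<in> F" using JO by (auto simp: F_def T_def)
  then have "card F \<noteq> 0" using finO by (auto simp: F_def)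
  then have "card F \<noteq> 1" using \<open>p dvd card F\<close> p by auto
  then have "F \<noteq> {J}" by auto
  then obtain S where S: "S \<in> F" "S \<noteq> J" using JF by blast
  then have "S \<in> \<Omega>" by (simp add: F_def)
  then obtain g where g: "g \<in> P" "S = conjg g ` J" unfolding \<Omega>_def by (rule imageE)
  have gc: "g \<in> carrier G" and ginv: "inv g \<in> P" using g Pc sP by (auto simp: subgroup.m_inv_closed)
  have ne: "conjg (inv g) ` J \<noteq> J"
  proof
    assume "conjg (inv g) ` J = J"
    then have "S = conjg g ` conjg (inv g) ` J" using g by simp
    then show False using S gc Jc by (simp add: conjg_image_conj conjg_image_one)
  qed
  have "\<not> conjg (inv g) ` J \<subseteq> J"
    using conjg_image_subset_imp_eq[OF _ finJ Jc] ne gc by blast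
  then obtain j where j: "j \<in> J" "conjg (inv g) j \<notin> J" by auto
  have jT: "j \<in> T" using j(1) J(2)[OF j(1)] JP Pc by (simp add: T_def) blast
  have "\<forall>g\<in>T. conjg g ` S = S" using S(1) \<open>S \<in> \<Omega>\<close> by (simp add: F_def)
  then have jS: "conjg j ` conjg g ` J = conjg g ` J" using jT g(2) by simp
  have jc: "j \<in> carrier G" using j Jc by auto
  have "conjg (conjg (inv g) j) ` J = conjg (inv g) ` conjg j ` conjg g ` J"
    using gc jc Jc by (simp add: conjg_image_conj) (simp add: conjg_def m_assoc)
  also have "\<dots> = J" using jS gc Jc by (simp add: conjg_image_conj conjg_image_one)
  finally show ?thesis using that[of "conjg (inv g) j"] j U(2)[OF ginv] J(1) by blast
qed

text \<open>Since Q normalises P, the n-th power of x q lies in P times the n-th power of q. A power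
  of p that kills q therefore sends x q into P.\<close>

lemma p_subgroup_set_mult:
  assumes P: "p_subgroup p P" and Q: "p_subgroup p Q" and norm: "\<And>q. q \<in> Q \<Longrightarrow> conjg q ` P \<subseteq> P"
  shows "p_subgroup p (P <#> Q)"
proof -
  have sP: "subgroup P G" and sQ: "subgroup Q G" and Pc: "P \<subseteq> carrier G" and Qc: "Q \<subseteq> carrier G"
    using P Q by (auto simp: p_subgroup_def dest: subgroup.subset)
  have mult: "\<exists>z\<in>P. (x \<otimes> q) \<otimes> (y \<otimes> r) = z \<otimes> (q \<otimes> r)" if "x \<in> P" "y \<in> P" "q \<in> Q" "r \<in> carrier G" for x y q r
  proof
    show "x \<otimes> conjg q y \<in> P" using that norm sP by (simp add: image_subset_iff subgroup.m_closed)
    have c: "x \<in> carrier G" "y \<in> carrier G" "q \<in> carrier G" using that Pc Qc by auto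
    have "inv q \<otimes> (q \<otimes> r) = r" using c that by (simp flip: m_assoc)
    then show "(x \<otimes> q) \<otimes> (y \<otimes> r) = (x \<otimes> conjg q y) \<otimes> (q \<otimes> r)"
      using c that by (simp add: conjg_def m_assoc)
  qed
  have "subgroup (P <#> Q) G"
  proof (rule subgroupI)
    show "P <#> Q \<subseteq> carrier G" using Pc Qc by (rule set_mult_closed)
    show "P <#> Q \<noteq> {}" using sP sQ by (auto simp: set_mult_def dest: subgroup.one_closed)
  next
    fix a assume "a \<in> P <#> Q"
    then obtain x q where a: "a = x \<otimes> q" "x \<in> P" "q \<in> Q" by (auto simp: set_mult_def)
    then have c: "x \<in> carrier G" "q \<in> carrier G" using Pc Qc by auto
    have "inv a = conjg (inv q) (inv x) \<otimes> inv q" using a c by (simp add: conjg_def inv_mult_group m_assoc)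
    moreover have "conjg (inv q) (inv x) \<in> P"
    proof -
      have "inv q \<in> Q" "inv x \<in> P" using a sP sQ by (simp_all add: subgroup.m_inv_closed)
      then show ?thesis using norm by blast
    qed
    moreover have "inv q \<in> Q" using sQ a by (simp add: subgroup.m_inv_closed)
    ultimately show "inv a \<in> P <#> Q" unfolding set_mult_def by blast
  next
    fix a b assume "a \<in> P <#> Q" "b \<in> P <#> Q"
    then obtain x q y r where ab: "a = x \<otimes> q" "b = y \<otimes> r" "x \<in> P" "y \<in> P" "q \<in> Q" "r \<in> Q"
      by (auto simp: set_mult_def)
    then obtain z where "z \<in> P" "a \<otimes> b = z \<otimes> (q \<otimes> r)" using mult[of x y q r] Qc by blast
    moreover have "q \<otimes> r \<in> Q" using sQ ab by (simp add: subgroup.m_closed)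
    ultimately show "a \<otimes> b \<in> P <#> Q" unfolding set_mult_def by blast
  qed
  moreover have "\<exists>k::nat. a [^] (p ^ k) = \<one>" if PQ: "a \<in> P <#> Q" for a
  proof -
    obtain x q where a: "a = x \<otimes> q" "x \<in> P" "q \<in> Q" using PQ by (auto simp: set_mult_def)
    then have c: "x \<in> carrier G" "q \<in> carrier G" using Pc Qc by auto
    have pow: "\<exists>z\<in>P. a [^] n = z \<otimes> q [^] n" for n :: nat
    proof (induction n)
      case 0
      have "\<one> = \<one> \<otimes> q [^] (0::nat)" by simp
      then show ?case using sP subgroup.one_closed by (intro bexI[of _ \<one>]) auto
    next
      case (Suc n)
      then obtain z where z: "z \<in> P" "a [^] n = z \<otimes> q [^] n" by auto
      have "q [^] n \<in> Q" using a(3) sQ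
        by (induction n) (simp_all add: subgroup.m_closed subgroup.one_closed)
      then obtain w where "w \<in> P" "z \<otimes> q [^] n \<otimes> (x \<otimes> q) = w \<otimes> (q [^] n \<otimes> q)"
        using mult[OF z(1) a(2), of "q [^] n" q] c by blast
      then show ?case using z a by (intro bexI[of _ w]) simp_all
    qed
    obtain k :: nat where k: "q [^] (p ^ k) = \<one>" using Q a by (auto simp: p_subgroup_def)
    obtain z where z: "z \<in> P" "a [^] (p ^ k) = z \<otimes> \<one>" using pow[of "p ^ k"] k by auto
    obtain l :: nat where l: "z [^] (p ^ l) = \<one>" using P z by (auto simp: p_subgroup_def)
    have "a [^] (p ^ (k + l)) = (a [^] (p ^ k)) [^] (p ^ l)"
      using a c by (simp add: nat_pow_pow power_add)
    then show ?thesis using z l Pc by (auto simp: subset_iff)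
  qed
  ultimately show ?thesis by (auto simp: p_subgroup_def)
qed

section \<open>The theorems of Baer--Suzuki and Zenkov\<close>

text \<open>The argument is that of Alperin and Lyons: two distinct maximal subsets of \<open>K\<close>
  that lie in \<open>p\<close>-subgroups, chosen with an intersection of maximal size, could both be enlarged
  inside the normaliser of their intersection, and the enlargements generate a \<open>p\<close>-subgroup.\<close>

theorem baer_suzuki:
  assumes fin: "finite (carrier G)" and p: "prime p" and K: "K \<subseteq> carrier G"
    and conj: "\<And>x. x \<in> K \<Longrightarrow> conjg x ` K \<subseteq> K"
    and pairs: "\<And>x y. \<lbrakk>x \<in> K; y \<in> K\<rbrakk> \<Longrightarrow> \<exists>P. p_subgroup p P \<and> x \<in> P \<and> y \<in> P"
  obtains P where "p_subgroup p P" "K \<subseteq> P"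
proof -
  define C where "C = {U. U \<subseteq> K \<and> (\<exists>P. p_subgroup p P \<and> U \<subseteq> P)}"
  define M where "M = {U \<in> C. \<forall>V\<in>C. U \<subseteq> V \<longrightarrow> U = V}"
  have finK: "finite K" using K fin by (rule finite_subset)
  have finC: "finite C" unfolding C_def using finK by simp
  have extend: "\<exists>V\<in>M. U \<subseteq> V" if "U \<in> C" for U
    using finite_has_maximal2[OF finC that] by (auto simp: M_def)
  \<comment> \<open>By maximality U already contains all elements of K in the subgroup it
    generates.\<close>
  have M_gen: "p_subgroup p (generate G U)" "U = K \<inter> generate G U" if U: "U \<in> M" for U
  proof -
    obtain P where P: "p_subgroup p P" "U \<subseteq> P" and UK: "U \<subseteq> K" using U by (auto simp: M_def C_def)
    then have "generate G U \<subseteq> P" by (intro generate_subgroup_incl) (auto simp: p_subgroup_def)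
    moreover have "subgroup (generate G U) G" using UK K by (intro generate_is_subgroup) auto
    ultimately show p: "p_subgroup p (generate G U)" using P(1) p_subgroup_subset by blast
    have "K \<inter> generate G U \<in> C" using p by (auto simp: C_def)
    moreover have "U \<subseteq> K \<inter> generate G U" using UK by (auto intro: generate.incl)
    ultimately show "U = K \<inter> generate G U" using U by (auto simp: M_def)
  qed
  \<comment> \<open>Elements of K normalise K, so the subgroup generated by U does too; it then
    normalises U, its intersection with K. This is the normal subset needed for
    \<open>p_subgroup_normalizer_grows\<close>.\<close>
  have M_conj: "conjg g ` U \<subseteq> U" if U: "U \<in> M" and g: "g \<in> generate G U" for U g
  proof -
    have UK: "U \<subseteq> K" using U by (auto simp: M_def C_def)
    have Uc: "U \<subseteq> carrier G" using UK K by auto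
    have "U \<subseteq> {g \<in> carrier G. conjg g ` K = K}"
    proof
      fix x assume "x \<in> U"
      then have x: "x \<in> K" "x \<in> carrier G" using UK Uc by auto
      then show "x \<in> {g \<in> carrier G. conjg g ` K = K}"
        using conjg_image_subset_imp_eq[OF x(2) finK K conj[OF x(1)]] by simp
    qed
    then have "generate G U \<subseteq> {g \<in> carrier G. conjg g ` K = K}"
      by (rule generate_subgroup_incl) (rule subgroup_normalizer[OF K finK])
    then have gK: "conjg g ` K = K" using g by auto
    have gen: "conjg g u \<in> generate G U" if "u \<in> U" for u
      by (rule subgroup_conjg_closed[OF generate_is_subgroup[OF Uc] g generate.incl[OF that]])
    show ?thesis
    proof (rule image_subsetI)
      fix u assume u: "u \<in> U"
      then have "conjg g u \<in> K" using UK gK by blast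
      then have "conjg g u \<in> K \<inter> generate G U" using gen[OF u] by simp
      then show "conjg g u \<in> U" unfolding M_gen(2)[OF U, symmetric] .
    qed
  qed
  have unique: "U = V" if UV: "U \<in> M" "V \<in> M" for U V
  proof (rule ccontr)
    assume "U \<noteq> V"
    define D where "D = {(U, V). U \<in> M \<and> V \<in> M \<and> U \<noteq> V}"
    define c where "c = (\<lambda>(U, V). card (U \<inter> V :: 'a set))"
    have "finite M" using finC by (simp add: M_def)
    then have "finite (M \<times> M)" by simp
    then have finD: "finite D" by (rule finite_subset[rotated]) (auto simp: D_def)
    have "D \<noteq> {}" using UV \<open>U \<noteq> V\<close> by (auto simp: D_def)
    then have "Max (c ` D) \<in> c ` D" using finD by simp
    then obtain UV where "UV \<in> D" and UV_max: "c UV = Max (c ` D)" by auto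
    then obtain U V where UV': "UV = (U, V)" "U \<in> M" "V \<in> M" "U \<noteq> V" by (auto simp: D_def)
    have maxi: "card (U' \<inter> V') \<le> card (U \<inter> V)" if "U' \<in> M" "V' \<in> M" "U' \<noteq> V'" for U' V'
    proof -
      have "c (U', V') \<le> Max (c ` D)" using finD that by (intro Max_ge) (auto simp: D_def)
      then show ?thesis using UV_max UV'(1) by (simp add: c_def)
    qed
    define J where "J = U \<inter> V"
    have UK: "U \<subseteq> K" "V \<subseteq> K" using UV' by (auto simp: M_def C_def)
    have JK: "J \<subseteq> K" and Jc: "J \<subseteq> carrier G" using UK K by (auto simp: J_def)
    have finJ: "finite J" using JK finK by (rule finite_subset)
    have J_conj: "conjg g ` J = J" if "g \<in> J" for g
    proof (rule conjg_image_subset_imp_eq)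
      have "g \<in> generate G U" "g \<in> generate G V" using that by (auto simp: J_def intro: generate.incl)
      then show "conjg g ` J \<subseteq> J" using M_conj[OF UV'(2), of g] M_conj[OF UV'(3), of g] by (auto simp: J_def)
    qed (use that Jc finJ in auto)
    have grow: "\<exists>x. x \<in> W - J \<and> conjg x ` J = J" if W: "W \<in> M" "J \<subset> W" for W
    proof -
      have sub: "W \<subseteq> generate G W" by (auto intro: generate.incl)
      have fin: "finite (generate G W)"
        using p_subgroup_carrier[OF M_gen(1)[OF W(1)]] fin by (rule finite_subset)
      show ?thesis
      proof (rule p_subgroup_normalizer_grows[OF M_gen(1)[OF W(1)] fin p sub _ W(2)])
        show "conjg g ` W \<subseteq> W" if "g \<in> generate G W" for g using that by (rule M_conj[OF W(1)])
        show "conjg g ` J = J" if "g \<in> J" for g using that by (rule J_conj)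
      qed blast
    qed
    have "J \<subset> U" "J \<subset> V" using UV' by (auto simp: J_def M_def)
    then obtain x y where x: "x \<in> U - J" "conjg x ` J = J" and y: "y \<in> V - J" "conjg y ` J = J"
      using grow[OF UV'(2)] grow[OF UV'(3)] by blast
    obtain Q where Q: "p_subgroup p Q" "x \<in> Q" "y \<in> Q" using pairs[of x y] x y UK by blast
    \<comment> \<open>The enlarging elements x and y lie in a common p-subgroup Q. Cutting Q down to
      the normaliser of J keeps both and makes the product with the subgroup generated by J a
      p-subgroup.\<close>
    define N where "N = Q \<inter> {g \<in> carrier G. conjg g ` J = J}"
    have "subgroup Q G" using Q(1) by (simp add: p_subgroup_def)
    then have "subgroup N G" unfolding N_def
      by (intro subgroups_Inter_pair subgroup_normalizer Jc finJ)
    then have pN: "p_subgroup p N" using p_subgroup_subset[OF Q(1)] by (simp add: N_def)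
    have xyN: "x \<in> N" "y \<in> N" using Q x y UK K by (auto simp: N_def)
    have sJ: "subgroup (generate G J) G" using Jc by (rule generate_is_subgroup)
    have pJ: "p_subgroup p (generate G J)"
      by (rule p_subgroup_subset[OF M_gen(1)[OF UV'(2)] sJ]) (rule mono_generate, simp add: J_def)
    have pR: "p_subgroup p (generate G J <#> N)"
    proof (rule p_subgroup_set_mult[OF pJ pN])
      fix q assume q: "q \<in> N"
      then interpret group_hom G G "conjg q" by unfold_locales (simp add: N_def conjg_in_hom)
      show "conjg q ` generate G J \<subseteq> generate G J" using generate_img[OF Jc] q by (simp add: N_def)
    qed
    have "J \<subseteq> generate G J <#> N"
    proof
      fix j assume "j \<in> J"
      then have "j \<in> generate G J" "j = j \<otimes> \<one>" using Jc by (auto intro: generate.incl)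
      then show "j \<in> generate G J <#> N" unfolding set_mult_def
        using subgroup.one_closed[OF \<open>subgroup N G\<close>] by blast
    qed
    moreover have "z \<in> generate G J <#> N" if "z \<in> N" for z
    proof -
      have "z = \<one> \<otimes> z" using that by (auto simp: N_def)
      then show ?thesis unfolding set_mult_def using that generate.one by blast
    qed
    ultimately have "J \<union> {x, y} \<in> C" using pR JK x y xyN UK unfolding C_def by blast
    then obtain Z where Z: "Z \<in> M" "J \<union> {x, y} \<subseteq> Z" using extend by blast
    have finZ: "finite Z" using Z(1) finK by (auto simp: M_def C_def intro: finite_subset)
    \<comment> \<open>Z meets W in more than J, which the maximal size of J forbids for distinct
      members of M. Taking W to be U and then V gives U = Z = V.\<close>
    have "Z = W" if W: "W \<in> M" "w \<in> W - J" "w \<in> Z" "J \<subseteq> W" for W w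
    proof (rule ccontr)
      assume "Z \<noteq> W"
      then have "card (Z \<inter> W) \<le> card J" using maxi[OF Z(1) W(1)] by (simp add: J_def)
      moreover have "J \<subset> Z \<inter> W" using W Z by auto
      then have "card J < card (Z \<inter> W)" using finZ by (intro psubset_card_mono) auto
      ultimately show False by simp
    qed
    from this[of U x] this[of V y] show False using UV' x y Z by (auto simp: J_def)
  qed
  have "p_subgroup p {\<one>}" by (auto simp: p_subgroup_def triv_subgroup)
  then have "{} \<in> C" by (auto simp: C_def)
  then obtain U where U: "U \<in> M" using extend by blast
  have "K \<subseteq> U"
  proof
    fix x assume x: "x \<in> K"
    then have "{x} \<in> C" using pairs[OF x x] by (auto simp: C_def)
    then obtain V where "V \<in> M" "x \<in> V" using extend by blast
    then show "x \<in> U" using unique U by auto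
  qed
  then show ?thesis using U that by (auto simp: M_def C_def)
qed

end

text \<open>For a finite subgroup H this says that its Fitting subgroup is trivial.\<close>

definition (in group) p_core_free :: "'a set \<Rightarrow> bool"
  where "p_core_free H \<longleftrightarrow> (\<forall>p P. prime p \<longrightarrow> p_subgroup p P \<longrightarrow> P \<subseteq> H \<longrightarrow>
    (\<forall>h\<in>H. conjg h ` P \<subseteq> P) \<longrightarrow> P = {\<one>})"

context group
begin

lemma subgroup_nat_pow_closed: "\<lbrakk>subgroup H G; x \<in> H\<rbrakk> \<Longrightarrow> x [^] (n::nat) \<in> H"
  by (induction n) (simp_all add: subgroup.m_closed subgroup.one_closed)

text \<open>Turns the conclusion of \<open>zenkov\<close>, a conjugacy class lying in some
  p-subgroup, into a p-subgroup that is invariant under K, to be compared with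
  \<open>p_core_free\<close>.\<close>

lemma class_in_p_subgroup_normal:
  assumes K: "subgroup K G" and P: "p_subgroup p P" "(\<lambda>h. conjg h x) ` K \<subseteq> P" and x: "x \<in> carrier G"
  shows "p_subgroup p (generate G ((\<lambda>h. conjg h x) ` K))" (is "?one")
    and "h \<in> K \<Longrightarrow> conjg h ` generate G ((\<lambda>h. conjg h x) ` K) \<subseteq> generate G ((\<lambda>h. conjg h x) ` K)"
proof -
  let ?C = "(\<lambda>h. conjg h x) ` K"
  have Kc: "K \<subseteq> carrier G" using K by (rule subgroup.subset)
  have Cc: "?C \<subseteq> carrier G" using Kc x by auto
  have "generate G ?C \<subseteq> P" using P by (intro generate_subgroup_incl) (auto simp: p_subgroup_def)
  then show ?one using p_subgroup_subset[OF P(1)] generate_is_subgroup[OF Cc] by blast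
  assume h: "h \<in> K"
  show "conjg h ` generate G ?C \<subseteq> generate G ?C"
  proof -
    have hc: "h \<in> carrier G" using h Kc by auto
    then interpret group_hom G G "conjg h" by unfold_locales (simp add: conjg_in_hom)
    have "conjg h ` ?C \<subseteq> ?C"
    proof (clarify)
      fix k assume k: "k \<in> K"
      then have "conjg h (conjg k x) = conjg (h \<otimes> k) x" using hc Kc x by (simp add: conjg_conj subset_iff)
      moreover have "h \<otimes> k \<in> K" using h k K by (simp add: subgroup.m_closed)
      ultimately show "conjg h (conjg k x) \<in> ?C" by blast
    qed
    then have "generate G (conjg h ` ?C) \<subseteq> generate G ?C" by (rule mono_generate)
    then show ?thesis using generate_img[OF Cc] by simp
  qed
qed

lemma subgroup_centralizer: "d \<in> carrier G \<Longrightarrow> subgroup {g \<in> carrier G. conjg g d = d} G"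
  using subgroup_normalizer[of "{d}"] by simp

text \<open>If \<open>A\<close> and some \<open>hBh\<inverse>\<close> generate \<open>H\<close>, their intersection is central in \<open>H\<close>. Otherwise the induction
  hypothesis in the subgroup generated by \<open>A\<close> and \<open>hBh\<inverse>\<close>, which contains \<open>hxh\<inverse>\<close>, puts \<open>x\<close> and \<open>hxh\<inverse>\<close>
  into a common \<open>p\<close>-subgroup, and Baer--Suzuki applies.\<close>

theorem zenkov:
  assumes fin: "finite (carrier G)" and p: "prime p"
    and A: "subgroup A G" "\<And>a b. \<lbrakk>a \<in> A; b \<in> A\<rbrakk> \<Longrightarrow> a \<otimes> b = b \<otimes> a"
  shows "\<lbrakk>subgroup H G; A \<subseteq> H; subgroup B G; B \<subseteq> H; \<forall>a\<in>B. \<forall>b\<in>B. a \<otimes> b = b \<otimes> a;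
      \<forall>h\<in>H. \<not> A \<inter> conjg h ` B \<subset> A \<inter> B; x \<in> A \<inter> B; x [^] (p ^ (k::nat)) = \<one>\<rbrakk>
    \<Longrightarrow> \<exists>P. p_subgroup p P \<and> (\<lambda>h. conjg h x) ` H \<subseteq> P"
proof (induction "card H" arbitrary: H B rule: less_induct)
  case less
  note H = less.prems(1) and AH = less.prems(2) and B = less.prems(3) and BH = less.prems(4)
    and Bcomm = less.prems(5) and minimal = less.prems(6) and x = less.prems(7) and xp = less.prems(8)
  have Hc: "H \<subseteq> carrier G" using H by (rule subgroup.subset)
  have finH: "finite H" using Hc fin by (rule finite_subset)
  have Ac: "A \<subseteq> carrier G" and Bc: "B \<subseteq> carrier G" using AH BH Hc by auto
  have xH: "x \<in> H" and xc: "x \<in> carrier G" using x AH Hc by auto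
  have BhH: "conjg h ` B \<subseteq> H" if "h \<in> H" for h
    using that BH subgroup_conjg_closed[OF H] by blast
  show ?case
  proof (cases "\<exists>h\<in>H. generate G (A \<union> conjg h ` B) = H")
    case True
    then obtain h where h: "h \<in> H" "generate G (A \<union> conjg h ` B) = H" by blast
    have hc: "h \<in> carrier G" using h Hc by auto
    have central: "conjg g d = d" if d: "d \<in> A \<inter> conjg h ` B" and g: "g \<in> H" for d g
    proof -
      have dc: "d \<in> carrier G" using d Ac by auto
      have "A \<union> conjg h ` B \<subseteq> {g \<in> carrier G. conjg g d = d}"
      proof
        fix c assume "c \<in> A \<union> conjg h ` B"
        moreover have "c \<in> carrier G \<and> conjg c d = d" if "c \<in> A"
          using that d A(2)[of c d] Ac dc by (auto simp: conjg_eq_self_iff)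
        moreover have "c \<in> carrier G \<and> conjg c d = d" if "c \<in> conjg h ` B"
        proof -
          obtain b b' where b: "c = conjg h b" "b \<in> B" "d = conjg h b'" "b' \<in> B" using \<open>c \<in> conjg h ` B\<close> d by auto
          then have bc: "b \<in> carrier G" "b' \<in> carrier G" using Bc by auto
          have "c \<otimes> d = d \<otimes> c" using b bc hc Bcomm by (simp flip: conjg_mult)
          then show ?thesis using b bc hc by (simp add: conjg_eq_self_iff)
        qed
        ultimately show "c \<in> {g \<in> carrier G. conjg g d = d}" by auto
      qed
      then have "H \<subseteq> {g \<in> carrier G. conjg g d = d}"
        unfolding h(2)[symmetric] by (rule generate_subgroup_incl) (rule subgroup_centralizer[OF dc])
      then show ?thesis using g by auto
    qed
    \<comment> \<open>A central element is unchanged when conjugated back by \<open>inv h\<close>,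
      which lands it in B. Minimality then makes the two intersections equal, so x itself is
      central.\<close>
    have "A \<inter> conjg h ` B \<subseteq> A \<inter> B"
    proof
      fix d assume d: "d \<in> A \<inter> conjg h ` B"
      then obtain b where b: "b \<in> B" "d = conjg h b" by auto
      have "inv h \<in> H" using H h by (simp add: subgroup.m_inv_closed)
      then have "d = conjg (inv h) d" using central[OF d] by simp
      also have "\<dots> = b" using b Bc hc by (auto simp: subset_iff)
      finally show "d \<in> A \<inter> B" using b d by simp
    qed
    moreover have "\<not> A \<inter> conjg h ` B \<subset> A \<inter> B" using bspec[OF minimal h(1)] .
    ultimately have "x \<in> A \<inter> conjg h ` B" using x by blast
    then have "conjg g x = x" if "g \<in> H" for g using central that by blast
    then have "(\<lambda>h. conjg h x) ` H \<subseteq> generate G {x}" by (auto intro: generate.incl)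
    then show ?thesis using p_subgroup_generate_singleton[OF xc xp] by blast
  next
    case False
    let ?K = "(\<lambda>h. conjg h x) ` H"
    have near: "\<exists>P. p_subgroup p P \<and> x \<in> P \<and> conjg h x \<in> P" if h: "h \<in> H" for h
    proof -
      define L where "L = generate G (A \<union> conjg h ` B)"
      have ABc: "A \<union> conjg h ` B \<subseteq> carrier G" using Ac BhH[OF h] Hc by auto
      have L: "subgroup L G" unfolding L_def using ABc by (rule generate_is_subgroup)
      have "L \<subseteq> H" unfolding L_def using AH BhH[OF h] H by (intro generate_subgroup_incl) auto
      moreover have "L \<noteq> H" using False h by (auto simp: L_def)
      ultimately have LH: "L \<subset> H" by auto
      have AL: "A \<subseteq> L" and BhL: "conjg h ` B \<subseteq> L" unfolding L_def by (auto intro: generate.incl)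
      have eq: "A \<inter> (B \<inter> L) = A \<inter> B" using AL by auto
      \<comment> \<open>The induction is applied to L with B \<inter> L in place of B. Minimality is
        inherited: A lies in L, so for l in L only elements of B \<inter> L can be conjugated by l
        into A.\<close>
      have "\<exists>P. p_subgroup p P \<and> (\<lambda>l. conjg l x) ` L \<subseteq> P"
      proof (rule less.hyps)
        show "card L < card H" using LH finH by (rule psubset_card_mono[rotated])
        show "subgroup (B \<inter> L) G" using B L by (rule subgroups_Inter_pair)
        show "\<forall>l\<in>L. \<not> A \<inter> conjg l ` (B \<inter> L) \<subset> A \<inter> (B \<inter> L)"
        proof
          fix l assume l: "l \<in> L"
          have lc: "l \<in> carrier G" and linv: "inv l \<in> L"
            using l L subgroup.subset by (auto simp: subgroup.m_inv_closed)
          have "A \<inter> conjg l ` (B \<inter> L) = A \<inter> conjg l ` B"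
          proof -
            have "b \<in> L" if "b \<in> B" "conjg l b \<in> A" for b
            proof -
              have "conjg (inv l) (conjg l b) \<in> L" using subgroup_conjg_closed[OF L linv] that AL by blast
              then show ?thesis using that Bc lc by (simp add: subset_iff)
            qed
            then show ?thesis by auto
          qed
          moreover have "l \<in> H" using l LH by blast
          ultimately show "\<not> A \<inter> conjg l ` (B \<inter> L) \<subset> A \<inter> (B \<inter> L)" using eq bspec[OF minimal] by simp
        qed
      qed (use L AL Bcomm x xp in \<open>simp_all add: subset_iff\<close>)
      then obtain P where P: "p_subgroup p P" "(\<lambda>l. conjg l x) ` L \<subseteq> P" by blast
      define R where "R = generate G ((\<lambda>l. conjg l x) ` L)"
      have R: "p_subgroup p R" "(\<lambda>l. conjg l x) ` L \<subseteq> R" "\<And>l. l \<in> L \<Longrightarrow> conjg l ` R \<subseteq> R"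
        unfolding R_def using class_in_p_subgroup_normal[OF L P xc] by (auto intro: generate.incl)
      define y where "y = conjg h x"
      have hc: "h \<in> carrier G" using h Hc by auto
      have yc: "y \<in> carrier G" using hc xc by (simp add: y_def)
      have yL: "y \<in> L" using BhL x by (auto simp: y_def)
      have "y [^] (p ^ k) = conjg h \<one>" unfolding y_def xp[symmetric] using hc xc by (simp add: conjg_pow)
      then have Y: "p_subgroup p (generate G {y})"
        using yc hc by (intro p_subgroup_generate_singleton[of y p k]) auto
      have "generate G {y} \<subseteq> L" using yL L by (intro generate_subgroup_incl) auto
      \<comment> \<open>The element y lies in L and so normalises R, which contains x; the product
        thus holds both x and y.\<close>
      then have S: "p_subgroup p (R <#> generate G {y})" using R(3) by (intro p_subgroup_set_mult[OF R(1) Y]) blast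
      have "\<one> \<in> R" using R(1) by (auto simp: p_subgroup_def dest: subgroup.one_closed)
      moreover have "y \<in> generate G {y}" by (auto intro: generate.incl)
      moreover have "y = \<one> \<otimes> y" using yc by simp
      ultimately have 1: "y \<in> R <#> generate G {y}" unfolding set_mult_def by blast
      have "conjg \<one> x \<in> R" using R(2) subgroup.one_closed[OF L] by blast
      then have "x \<in> R" using xc by simp
      moreover have "x = x \<otimes> \<one>" using xc by simp
      ultimately have "x \<in> R <#> generate G {y}" unfolding set_mult_def using generate.one by blast
      then show ?thesis using S 1 by (auto simp: y_def)
    qed
    have 1: "?K \<subseteq> carrier G" using Hc xc by auto
    have 2: "conjg u ` ?K \<subseteq> ?K" if u: "u \<in> ?K" for u
    proof (clarify)
      fix h assume h: "h \<in> H"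
      have uH: "u \<in> H" using u xH subgroup_conjg_closed[OF H] by auto
      then have "conjg u (conjg h x) = conjg (u \<otimes> h) x" using h Hc xc by (simp add: conjg_conj subset_iff)
      moreover have "u \<otimes> h \<in> H" using uH h H by (simp add: subgroup.m_closed)
      ultimately show "conjg u (conjg h x) \<in> ?K" by blast
    qed
    have 3: "\<exists>P. p_subgroup p P \<and> u \<in> P \<and> v \<in> P" if u: "u \<in> ?K" and v: "v \<in> ?K" for u v
    proof -
      obtain a b where ab: "a \<in> H" "b \<in> H" "u = conjg a x" "v = conjg b x" using u v by auto
      then have c: "a \<in> carrier G" "b \<in> carrier G" using Hc by auto
      \<comment> \<open>Conjugating by \<open>inv a\<close> reduces an arbitrary pair of conjugates
        of x to a pair containing x.\<close>
      have "inv a \<otimes> b \<in> H" using ab H by (simp add: subgroup.m_closed subgroup.m_inv_closed)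
      then obtain P where P: "p_subgroup p P" "x \<in> P" "conjg (inv a \<otimes> b) x \<in> P" using near by blast
      have "v = conjg a (conjg (inv a \<otimes> b) x)" using ab c xc by (simp add: conjg_conj m_assoc[symmetric])
      then have "u \<in> conjg a ` P" "v \<in> conjg a ` P" using ab P by auto
      then show ?thesis using p_subgroup_conjg[OF P(1) c(1)] by blast
    qed
    show ?thesis by (rule baer_suzuki[OF fin p 1 2 3]) blast+
  qed
qed

section \<open>Trivially intersecting conjugates and the lcm bound\<close>

lemma exists_prime_order_power:
  assumes fin: "finite (carrier G)" and x: "x \<in> carrier G" "x \<noteq> \<one>"
  obtains p :: nat and n :: nat where "prime p" "x [^] n \<noteq> \<one>" "(x [^] n) [^] p = \<one>"
proof -
  have "ord x \<noteq> 1" using x ord_eq_1 by auto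
  then obtain p where p: "prime p" "p dvd ord x" by (metis prime_factor_nat)
  then obtain n where n: "ord x = p * n" by auto
  have "ord x > 0" using ord_ge_1[OF fin x(1)] by simp
  then have "n > 0" "n < ord x" using n p prime_gt_1_nat[of p] by auto
  then have "\<not> ord x dvd n" by (auto dest: dvd_imp_le)
  then have "x [^] n \<noteq> \<one>" using x pow_eq_id by auto
  moreover have "(x [^] n) [^] p = \<one>" using pow_ord_eq_1[OF x(1)] x n by (simp add: nat_pow_pow mult.commute)
  ultimately show ?thesis using p that by blast
qed

text \<open>Choose h with |A \<inter> hA(inv h)| least, which implies the minimality under inclusion
  that \<open>zenkov\<close> asks for. A nontrivial element of this intersection would have a power
  of prime order p, whose H-class would generate a nontrivial normal p-subgroup of H.\<close>

lemma exists_disjoint_conjg: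
  assumes fin: "finite (carrier G)" and H: "subgroup H G" "p_core_free H"
    and A: "subgroup A G" "A \<subseteq> H" "\<And>a b. \<lbrakk>a \<in> A; b \<in> A\<rbrakk> \<Longrightarrow> a \<otimes> b = b \<otimes> a"
  obtains h where "h \<in> H" "A \<inter> conjg h ` A = {\<one>}"
proof -
  have Hc: "H \<subseteq> carrier G" using H(1) by (rule subgroup.subset)
  have Ac: "A \<subseteq> carrier G" using A(2) Hc by auto
  have finA: "finite A" using Ac fin by (rule finite_subset)
  define c where "c h = card (A \<inter> conjg h ` A)" for h
  have "\<one> \<in> H" using H(1) by (rule subgroup.one_closed)
  then obtain h where h: "h \<in> H" and min: "\<And>g. g \<in> H \<Longrightarrow> c h \<le> c g"
    using ex_has_least_nat[of "\<lambda>h. h \<in> H" \<one> c] by blast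
  have hc: "h \<in> carrier G" using h Hc by auto
  let ?B = "conjg h ` A"
  have B: "subgroup ?B G" using A(1) hc by (rule subgroup_conjg_image)
  have "A \<inter> ?B \<subseteq> {\<one>}"
  proof (rule ccontr)
    assume "\<not> A \<inter> ?B \<subseteq> {\<one>}"
    then obtain x where x: "x \<in> A \<inter> ?B" "x \<noteq> \<one>" by auto
    then have xc: "x \<in> carrier G" using Ac by auto
    obtain p n :: nat where p: "prime p" and n: "x [^] n \<noteq> \<one>" "(x [^] n) [^] p = \<one>"
      using exists_prime_order_power[OF fin xc x(2)] .
    define y where "y = x [^] n"
    have sub: "subgroup (A \<inter> ?B) G" using A(1) B by (rule subgroups_Inter_pair)
    have y: "y \<in> A \<inter> ?B" unfolding y_def using sub x(1) by (rule subgroup_nat_pow_closed)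
    have yc: "y \<in> carrier G" using y Ac by auto
    have "\<exists>P. p_subgroup p P \<and> (\<lambda>h. conjg h y) ` H \<subseteq> P"
    proof (rule zenkov[OF fin p A(1) A(3) H(1) A(2) B _ _ _ y])
      show "?B \<subseteq> H" using subgroup_conjg_closed[OF H(1) h] A(2) by blast
      show "\<forall>a\<in>?B. \<forall>b\<in>?B. a \<otimes> b = b \<otimes> a"
        using A(3) Ac hc by (auto simp: subset_iff simp flip: conjg_mult)
      show "\<forall>g\<in>H. \<not> A \<inter> conjg g ` ?B \<subset> A \<inter> ?B"
      proof
        fix g assume g: "g \<in> H"
        then have "conjg g ` ?B = conjg (g \<otimes> h) ` A" using Hc hc Ac by (intro conjg_image_conj) auto
        moreover have "g \<otimes> h \<in> H" using g h H(1) by (simp add: subgroup.m_closed)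
        ultimately have "card (A \<inter> ?B) \<le> card (A \<inter> conjg g ` ?B)" using min[of "g \<otimes> h"] by (simp add: c_def)
        moreover have "finite (A \<inter> ?B)" using finA by simp
        ultimately show "\<not> A \<inter> conjg g ` ?B \<subset> A \<inter> ?B" using psubset_card_mono by (metis linorder_not_less)
      qed
      show "y [^] (p ^ 1) = \<one>" using n by (simp add: y_def)
    qed
    then obtain P where P: "p_subgroup p P" "(\<lambda>h. conjg h y) ` H \<subseteq> P" by blast
    define R where "R = generate G ((\<lambda>h. conjg h y) ` H)"
    have R: "p_subgroup p R" "(\<lambda>h. conjg h y) ` H \<subseteq> R" "\<And>h. h \<in> H \<Longrightarrow> conjg h ` R \<subseteq> R"
      unfolding R_def using class_in_p_subgroup_normal[OF H(1) P yc] by (auto intro: generate.incl)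
    have "(\<lambda>h. conjg h y) ` H \<subseteq> H" using subgroup_conjg_closed[OF H(1)] y A(2) by blast
    then have "R \<subseteq> H" unfolding R_def using H(1) by (rule generate_subgroup_incl)
    then have "R = {\<one>}" using H(2) p R unfolding p_core_free_def by blast
    moreover have "conjg \<one> y \<in> R" using R(2) \<open>\<one> \<in> H\<close> by blast
    ultimately show False using n yc by (simp add: y_def)
  qed
  moreover have "\<one> \<in> A \<inter> ?B" using A(1) B by (simp add: subgroup.one_closed)
  ultimately have "A \<inter> ?B = {\<one>}" by blast
  then show ?thesis using h that by blast
qed

text \<open>With \<open>A\<close> the cyclic group generated by \<open>a\<close> and \<open>A \<inter> iAi\<inverse> = 1\<close> for some \<open>i \<in> I\<close>, the map
  \<open>(x, c) \<mapsto> x i c x\<inverse> i\<inverse>\<close> embeds \<open>A \<times> (A \<inter> I)\<close> into \<open>I\<close>.\<close>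

lemma ord_mult_card_inter_le:
  assumes fin: "finite (carrier G)" and I: "I \<lhd> G" "p_core_free I"
    and central: "\<And>g. \<lbrakk>g \<in> carrier G; \<And>i. i \<in> I \<Longrightarrow> conjg g i = i\<rbrakk> \<Longrightarrow> g = \<one>"
    and a: "a \<in> carrier G"
  shows "ord a * card (generate G {a} \<inter> I) \<le> card I"
proof -
  interpret I: normal I G by (rule I(1))
  define A where "A = generate G {a}"
  have A: "subgroup A G" unfolding A_def using a by (intro generate_is_subgroup) simp
  have Ac: "A \<subseteq> carrier G" using A by (rule subgroup.subset)
  have comm: "x \<otimes> y = y \<otimes> x" if xy: "x \<in> A" "y \<in> A" for x y
  proof -
    obtain m n :: int where "x = a [^] m" "y = a [^] n" using xy generate_pow[OF a] by (auto simp: A_def)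
    then show ?thesis using a by (simp add: int_pow_mult[symmetric] add.commute)
  qed
  have conjI: "conjg g i \<in> I" if "g \<in> carrier G" "i \<in> I" for g i
    using I.inv_op_closed2[OF that] by (simp add: conjg_def)
  define H where "H = I <#> A"
  have H: "subgroup H G" unfolding H_def using I(1) A by (rule mult_norm_subgroup)
  have IH: "I \<subseteq> H"
  proof
    fix i assume "i \<in> I"
    moreover have "\<one> \<in> A" using A by (rule subgroup.one_closed)
    moreover have "i = i \<otimes> \<one>" using \<open>i \<in> I\<close> by simp
    ultimately show "i \<in> H" unfolding H_def set_mult_def by blast
  qed
  have AH: "A \<subseteq> H"
  proof
    fix x assume x: "x \<in> A"
    then have "x = \<one> \<otimes> x" using Ac by auto
    then show "x \<in> H" unfolding H_def set_mult_def using x I.one_closed by blast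
  qed
  \<comment> \<open>A normal p-subgroup P of H meets I in a normal p-subgroup of I, hence trivially.
    As P and I normalise each other, commutators lie in P \<inter> I, so P centralises I and is
    trivial by \<open>central\<close>.\<close>
  have "p_core_free H"
    unfolding p_core_free_def
  proof (intro allI impI)
    fix p :: nat and P assume p: "prime p" and P: "p_subgroup p P" "P \<subseteq> H" "\<forall>h\<in>H. conjg h ` P \<subseteq> P"
    have sP: "subgroup P G" and Pc: "P \<subseteq> carrier G"
      using P(1) by (auto simp: p_subgroup_def dest: subgroup.subset)
    have "subgroup (P \<inter> I) G" using sP I.subgroup_axioms by (rule subgroups_Inter_pair)
    then have "p_subgroup p (P \<inter> I)" using p_subgroup_subset[OF P(1)] by simp
    moreover have "\<forall>i\<in>I. conjg i ` (P \<inter> I) \<subseteq> P \<inter> I"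
    proof (intro ballI subsetI)
      fix i y assume i: "i \<in> I" and y: "y \<in> conjg i ` (P \<inter> I)"
      then have "y \<in> conjg i ` P" by blast
      moreover have "i \<in> H" using i IH by blast
      ultimately have "y \<in> P" using P(3) by blast
      then show "y \<in> P \<inter> I" using y i conjI by auto
    qed
    ultimately have triv: "P \<inter> I = {\<one>}" using I(2) p unfolding p_core_free_def by blast
    have "g = \<one>" if g: "g \<in> P" for g
    proof (rule central)
      show gc: "g \<in> carrier G" using g Pc by auto
      fix i assume i: "i \<in> I"
      have "conjg i (inv g) \<in> P" using P(3) i IH g sP by (meson image_subset_iff subgroup.m_inv_closed subsetD)
      then have 1: "g \<otimes> conjg i (inv g) \<in> P" using g sP by (simp add: subgroup.m_closed)
      have eq: "g \<otimes> conjg i (inv g) = conjg g i \<otimes> inv i" using gc i by (simp add: conjg_def m_assoc)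
      have "conjg g i \<otimes> inv i \<in> I" using conjI[OF gc i] i by simp
      then have "conjg g i \<otimes> inv i = \<one>" using 1 triv eq by auto
      then show "conjg g i = i" using gc i by (metis I.mem_carrier conjg_closed inv_closed inv_equality inv_inv)
    qed
    then show "P = {\<one>}" using sP subgroup.one_closed by blast
  qed
  then obtain h where h: "h \<in> H" "A \<inter> conjg h ` A = {\<one>}"
    using exists_disjoint_conjg[OF fin H _ A AH comm] by blast
  \<comment> \<open>Since A is abelian, the factor x from A does not change A under conjugation, so
    the conjugating element may be taken in I.\<close>
  then obtain i x where ix: "i \<in> I" "x \<in> A" "h = i \<otimes> x" by (auto simp: H_def set_mult_def)
  have ic: "i \<in> carrier G" using ix by simp
  have "conjg h ` A = conjg i ` conjg x ` A"
    unfolding ix(3) by (rule conjg_image_conj[symmetric]) (use ix ic Ac in auto)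
  also have "conjg x ` A = A"
  proof -
    have "conjg x y = y" if "y \<in> A" for y
      using comm[OF ix(2) that] ix(2) that Ac by (subst conjg_eq_self_iff) auto
    then show ?thesis by simp
  qed
  finally have disj: "A \<inter> conjg i ` A = {\<one>}" using h by simp
  define f where "f = (\<lambda>(x, c). x \<otimes> conjg i (c \<otimes> inv x))"
  have "inj_on f (A \<times> (A \<inter> I))"
  proof (rule inj_onI, clarify)
    fix x c x' c' assume x: "x \<in> A" "x' \<in> A" and c: "c \<in> A" "c' \<in> A" and eq: "f (x, c) = f (x', c')"
    \<comment> \<open>With w = c (inv x), equal values give \<open>inv x' \<otimes> x\<close> as the
      conjugate by i of \<open>w' \<otimes> inv w\<close>, an element of A \<inter> iA(inv i), which
      is trivial.\<close>
    define w w' where "w = c \<otimes> inv x" and "w' = c' \<otimes> inv x'"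
    have w: "w \<in> A" "w' \<in> A" unfolding w_def w'_def using x c A by (simp_all add: subgroup.m_closed subgroup.m_inv_closed)
    have car: "x \<in> carrier G" "x' \<in> carrier G" "c \<in> carrier G" "c' \<in> carrier G" "w \<in> carrier G" "w' \<in> carrier G"
      using x c w Ac by auto
    have e: "x \<otimes> conjg i w = x' \<otimes> conjg i w'" using eq by (simp add: f_def w_def w'_def)
    have "inv x' \<otimes> x = inv x' \<otimes> (x \<otimes> conjg i w) \<otimes> inv (conjg i w)" using car ic by (simp add: m_assoc)
    also have "\<dots> = conjg i w' \<otimes> inv (conjg i w)" unfolding e using car ic by (simp add: m_assoc[symmetric])
    also have "\<dots> = conjg i (w' \<otimes> inv w)" using car ic by (simp add: conjg_mult conjg_inv)
    finally have e2: "inv x' \<otimes> x = conjg i (w' \<otimes> inv w)" .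
    have "w' \<otimes> inv w \<in> A" "inv x' \<otimes> x \<in> A" using x w A by (simp_all add: subgroup.m_closed subgroup.m_inv_closed)
    then have "inv x' \<otimes> x \<in> A \<inter> conjg i ` A" unfolding e2 by auto
    then have "inv x' \<otimes> x = \<one>" using disj by auto
    then have xx: "x = x'" using car by (metis inv_closed inv_equality inv_inv)
    have "conjg i w = conjg i w'" using e xx car ic by simp
    then have "w = w'" using inj_onD[OF conjg_inj_on[OF ic Ac]] w by blast
    then show "x = x' \<and> c = c'" using xx car by (simp add: w_def w'_def)
  qed
  moreover have "f ` (A \<times> (A \<inter> I)) \<subseteq> I"
  proof clarify
    fix x c assume x: "x \<in> A" and c: "c \<in> A" "c \<in> I"
    have car: "x \<in> carrier G" "c \<in> carrier G" using x c Ac by auto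
    have "f (x, c) = conjg x (i \<otimes> c) \<otimes> inv i" using car ic by (simp add: f_def conjg_def m_assoc)
    then show "f (x, c) \<in> I" using conjI[OF car(1)] ix c by simp
  qed
  moreover have "finite I" using I.subset fin by (rule finite_subset)
  ultimately have "card (A \<times> (A \<inter> I)) \<le> card I" by (metis card_inj_on_le)
  then show ?thesis using generate_pow_card[OF a] by (simp add: A_def card_cartesian_product)
qed

text \<open>With s the common order of both cosets in \<open>G Mod I\<close>, the power a^s
  generates a subgroup of order t inside I, so \<open>ord_mult_card_inter_le\<close> yields s t^2
  \<le> |I|, and likewise s u^2 \<le> |I| for b. The product s t u is at most the larger of the
  two.\<close>

lemma lcm_ord_le_card:
  assumes fin: "finite (carrier G)" and I: "I \<lhd> G" "p_core_free I"
    and central: "\<And>g. \<lbrakk>g \<in> carrier G; \<And>i. i \<in> I \<Longrightarrow> conjg g i = i\<rbrakk> \<Longrightarrow> g = \<one>"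
    and ab: "a \<in> carrier G" "b \<in> carrier G" "I #> a = I #> b"
  shows "lcm (ord a) (ord b) \<le> card I"
proof -
  interpret I: normal I G by (rule I(1))
  interpret Q: group "G Mod I" by (rule I.factorgroup_is_group)
  define s where "s = Q.ord (I #> a)"
  have key: "\<exists>t. ord c = s * t \<and> s * t * t \<le> card I" if c: "c \<in> carrier G" "I #> c = I #> a" for c
  proof -
    have cQ: "I #> c \<in> carrier (G Mod I)" using c by (auto simp: carrier_FactGroup)
    have pow: "(I #> c) [^]\<^bsub>G Mod I\<^esub> n = I #> (c [^] n)" for n :: nat
      by (rule I.FactGroup_pow[OF c(1)])
    have "(I #> c) [^]\<^bsub>G Mod I\<^esub> ord c = \<one>\<^bsub>G Mod I\<^esub>"
      unfolding pow using c I.subset by (simp add: coset_mult_one)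
    then have "s dvd ord c" unfolding s_def c(2)[symmetric] using Q.pow_eq_id[OF cQ] by simp
    then obtain t where t: "ord c = s * t" by auto
    have "ord c > 0" using ord_ge_1[OF fin c(1)] by simp
    then have s0: "s \<noteq> 0" using t by auto
    have "I #> (c [^] s) = I" using Q.pow_ord_eq_1[OF cQ] pow by (simp add: s_def c(2))
    then have cI: "c [^] s \<in> I" using c I.subgroup_axioms by (metis coset_join1 nat_pow_closed I.subset)
    have ct: "ord (c [^] s) = t" using ord_pow[OF c(1), of s] t s0 by simp
    have cc: "c [^] s \<in> carrier G" using c by simp
    have sub: "generate G {c [^] s} \<subseteq> generate G {c} \<inter> I"
    proof -
      have sc: "subgroup (generate G {c}) G" using c by (intro generate_is_subgroup) simp
      have "c \<in> generate G {c}" by (auto intro: generate.incl)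
      then have "c [^] s \<in> generate G {c}" using subgroup_nat_pow_closed[OF sc] by blast
      then have "generate G {c [^] s} \<subseteq> generate G {c}" using sc by (intro generate_subgroup_incl) auto
      moreover have "generate G {c [^] s} \<subseteq> I" using cI I.subgroup_axioms by (intro generate_subgroup_incl) auto
      ultimately show ?thesis by blast
    qed
    have "finite (generate G {c} \<inter> I)" using I.subset fin by (meson finite_Int finite_subset)
    then have "t \<le> card (generate G {c} \<inter> I)"
      using card_mono[OF _ sub] generate_pow_card[OF cc] ct by simp
    then have "s * t * t \<le> s * t * card (generate G {c} \<inter> I)" by simp
    also have "\<dots> \<le> card I" using ord_mult_card_inter_le[OF fin I central c(1)] t by simp
    finally show ?thesis using t by blast
  qed
  obtain t where t: "ord a = s * t" "s * t * t \<le> card I" using key ab by blast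
  obtain u where u: "ord b = s * u" "s * u * u \<le> card I" using key[OF ab(2)] ab by metis
  have "ord a > 0" "ord b > 0" using ord_ge_1[OF fin ab(1)] ord_ge_1[OF fin ab(2)] by auto
  then have "s * (t * u) > 0" using t u by simp
  moreover have "lcm (ord a) (ord b) dvd s * (t * u)" using t u by (intro lcm_least) auto
  ultimately have "lcm (ord a) (ord b) \<le> s * (t * u)" by (intro dvd_imp_le)
  also have "\<dots> \<le> card I"
  proof (cases "t \<le> u")
    case True
    then have "s * (t * u) \<le> s * (u * u)" by (intro mult_le_mono) auto
    also have "\<dots> \<le> card I" using u(2) by (simp only: mult.assoc)
    finally show ?thesis .
  next
    case False
    then have "s * (t * u) \<le> s * (t * t)" by (intro mult_le_mono) auto
    also have "\<dots> \<le> card I" using t(2) by (simp only: mult.assoc)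
    finally show ?thesis .
  qed
  finally show ?thesis .
qed

end

section \<open>Orders of automorphisms of groups without normal \<open>p\<close>-subgroups\<close>

lemma AutoGroup_simps:
  "carrier (AutoGroup G) = auto G"
  "\<one>\<^bsub>AutoGroup G\<^esub> = (\<lambda>x\<in>carrier G. x)"
  "\<lbrakk>f \<in> auto G; g \<in> auto G\<rbrakk> \<Longrightarrow> f \<otimes>\<^bsub>AutoGroup G\<^esub> g = compose (carrier G) f g"
  by (simp_all add: AutoGroup_def BijGroup_def auto_def)

lemma BijGroup_pow_apply:
  assumes f: "f \<in> Bij S" and x: "x \<in> S"
  shows "(f [^]\<^bsub>BijGroup S\<^esub> (n::nat)) x = (f ^^ n) x"
proof -
  interpret group "BijGroup S" by (rule group_BijGroup)
  have car: "carrier (BijGroup S) = Bij S" by (simp add: BijGroup_def)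
  have pow: "f [^]\<^bsub>BijGroup S\<^esub> n \<in> Bij S" for n :: nat using nat_pow_closed[of f n] f car by simp
  have "\<forall>x\<in>S. (f [^]\<^bsub>BijGroup S\<^esub> n) x = (f ^^ n) x"
  proof (induction n)
    case (Suc n)
    show ?case
    proof
      fix x assume x: "x \<in> S"
      then have "f x \<in> S" using f Bij_imp_funcset by blast
      then show "(f [^]\<^bsub>BijGroup S\<^esub> Suc n) x = (f ^^ Suc n) x"
        using x Suc f pow[of n] by (simp add: BijGroup_def compose_def funpow_swap1)
    qed
  qed (simp add: BijGroup_def)
  then show ?thesis using x by blast
qed

lemma BijGroup_ord_dvd_iff:
  assumes f: "f \<in> Bij S"
  shows "group.ord (BijGroup S) f dvd n \<longleftrightarrow> (\<forall>x\<in>S. (f ^^ n) x = x)"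
proof -
  interpret group "BijGroup S" by (rule group_BijGroup)
  have carrier: "carrier (BijGroup S) = Bij S" by (simp add: BijGroup_def)
  then have car: "f \<in> carrier (BijGroup S)" using f by simp
  have "f [^]\<^bsub>BijGroup S\<^esub> n \<in> Bij S" using nat_pow_closed[OF car, of n] unfolding carrier .
  then have ext: "f [^]\<^bsub>BijGroup S\<^esub> n \<in> extensional S" by (rule Bij_imp_extensional)
  have one: "\<one>\<^bsub>BijGroup S\<^esub> = (\<lambda>x\<in>S. x)" by (simp add: BijGroup_def)
  have "f [^]\<^bsub>BijGroup S\<^esub> n = \<one>\<^bsub>BijGroup S\<^esub> \<longleftrightarrow> (\<forall>x\<in>S. (f [^]\<^bsub>BijGroup S\<^esub> n) x = x)"
    unfolding one
  proof
    assume "\<forall>x\<in>S. (f [^]\<^bsub>BijGroup S\<^esub> n) x = x"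
    then show "f [^]\<^bsub>BijGroup S\<^esub> n = (\<lambda>x\<in>S. x)"
      by (intro extensionalityI[OF ext restrict_extensional]) simp
  qed simp
  also have "\<dots> \<longleftrightarrow> (\<forall>x\<in>S. (f ^^ n) x = x)" by (simp cong: ball_cong add: BijGroup_pow_apply[OF f])
  finally have "f [^]\<^bsub>BijGroup S\<^esub> n = \<one>\<^bsub>BijGroup S\<^esub> \<longleftrightarrow> (\<forall>x\<in>S. (f ^^ n) x = x)" .
  then show ?thesis using pow_eq_id[OF car] by simp
qed

lemma finite_Bij: "finite S \<Longrightarrow> finite (Bij S)"
proof (rule finite_subset)
  show "Bij S \<subseteq> S \<rightarrow>\<^sub>E S" unfolding PiE_def using Bij_imp_extensional Bij_imp_funcset by blast
qed (simp add: finite_PiE)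

context group
begin

lemma ord_AutoGroup: "f \<in> auto G \<Longrightarrow> group.ord (AutoGroup G) f = group.ord (BijGroup (carrier G)) f"
proof -
  interpret B: group "BijGroup (carrier G)" by (rule group_BijGroup)
  have "x [^]\<^bsub>AutoGroup G\<^esub> n = x [^]\<^bsub>BijGroup (carrier G)\<^esub> n" for x and n :: nat
    unfolding AutoGroup_def by (simp add: B.nat_pow_consistent[symmetric])
  then show ?thesis
    using AutoGroup by (simp add: group.ord_def B.ord_def) (simp add: AutoGroup_def)
qed

lemma inner_in_auto:
  assumes g: "g \<in> carrier G"
  shows "restrict (conjg g) (carrier G) \<in> auto G"
proof -
  have "bij_betw (conjg g) (carrier G) (carrier G)"
    by (rule bij_betw_byWitness[where f' = "conjg (inv g)"]) (use g in auto)
  then show ?thesis using g by (auto simp: auto_def Bij_def hom_def conjg_mult)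
qed

text \<open>This is \<open>lcm_ord_le_card\<close> in Aut(G) with the inner automorphisms as I. The
  trivial centre makes \<iota> injective, so |I| = |G| and the absence of normal p-subgroups carries
  over from G to I.\<close>

lemma lcm_ord_auto_le:
  assumes fin: "finite (carrier G)" and core: "p_core_free (carrier G)"
    and center: "\<And>z. \<lbrakk>z \<in> carrier G; \<And>x. x \<in> carrier G \<Longrightarrow> conjg z x = x\<rbrakk> \<Longrightarrow> z = \<one>"
    and ab: "\<alpha> \<in> auto G" "\<beta> \<in> auto G"
    and y: "y \<in> carrier G" "\<And>n. n \<in> carrier G \<Longrightarrow> \<alpha> n = conjg y (\<beta> n)"
  shows "lcm (group.ord (AutoGroup G) \<alpha>) (group.ord (AutoGroup G) \<beta>) \<le> card (carrier G)"
proof -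
  let ?W = "AutoGroup G"
  interpret W: group ?W by (rule AutoGroup)
  note simps = AutoGroup_simps[where G = G]
  define \<iota> where "\<iota> g = restrict (conjg g) (carrier G)" for g
  have \<iota>: "\<iota> g \<in> auto G" if "g \<in> carrier G" for g unfolding \<iota>_def using that by (rule inner_in_auto)
  have \<iota>_apply: "\<iota> g x = conjg g x" if "x \<in> carrier G" for g x using that by (simp add: \<iota>_def)
  have hom: "\<iota> (g \<otimes> h) = \<iota> g \<otimes>\<^bsub>?W\<^esub> \<iota> h" if "g \<in> carrier G" "h \<in> carrier G" for g h
    unfolding simps(3)[OF \<iota>[OF that(1)] \<iota>[OF that(2)]]
    using that by (auto simp: compose_def \<iota>_def conjg_conj intro!: restrict_ext)
  interpret h: group_hom G ?W \<iota> by unfold_locales (auto simp: hom_def simps \<iota> hom)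
  have inj: "g = h" if gh: "g \<in> carrier G" "h \<in> carrier G" "\<iota> g = \<iota> h" for g h
  proof -
    have "inv h \<otimes> g = \<one>"
    proof (rule center)
      fix x assume x: "x \<in> carrier G"
      have "conjg (inv h \<otimes> g) x = conjg (inv h) (conjg g x)" using gh x by (simp add: conjg_conj)
      also have "conjg g x = conjg h x" using \<iota>_apply[OF x, of g] \<iota>_apply[OF x, of h] gh(3) by simp
      also have "conjg (inv h) (conjg h x) = x" using gh(2) x by (rule conjg_inv_conj)
      finally show "conjg (inv h \<otimes> g) x = x" .
    qed (use gh in simp)
    then show ?thesis using gh by (metis inv_closed inv_equality inv_inv)
  qed
  define I where "I = \<iota> ` carrier G"
  have auto_closed: "f x \<in> carrier G" if "f \<in> auto G" "x \<in> carrier G" for f x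
    using that by (auto simp: auto_def hom_def)
  have auto_conjg: "f (conjg g x) = conjg (f g) (f x)" if f: "f \<in> auto G" and "g \<in> carrier G" "x \<in> carrier G" for f g x
  proof -
    interpret f: group_hom G G f using f by unfold_locales (simp add: auto_def)
    show ?thesis using that by (simp add: conjg_def)
  qed
  \<comment> \<open>This identity gives normality of I, invariance of pulled-back p-subgroups, and
    triviality of the centraliser of I.\<close>
  have conj: "W.conjg f (\<iota> g) = \<iota> (f g)" if f: "f \<in> auto G" and g: "g \<in> carrier G" for f g
  proof -
    have fg: "f g \<in> carrier G" using f g by (rule auto_closed)
    have "f \<otimes>\<^bsub>?W\<^esub> \<iota> g = \<iota> (f g) \<otimes>\<^bsub>?W\<^esub> f"
      unfolding simps(3)[OF f \<iota>[OF g]] simps(3)[OF \<iota>[OF fg] f]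
      using f g fg by (auto simp: compose_def \<iota>_apply auto_conjg auto_closed intro!: restrict_ext)
    then have "W.conjg f (\<iota> g) = \<iota> (f g) \<otimes>\<^bsub>?W\<^esub> f \<otimes>\<^bsub>?W\<^esub> inv\<^bsub>?W\<^esub> f" by (simp add: W.conjg_def)
    also have "\<dots> = \<iota> (f g) \<otimes>\<^bsub>?W\<^esub> (f \<otimes>\<^bsub>?W\<^esub> inv\<^bsub>?W\<^esub> f)"
      by (rule W.m_assoc) (use f \<iota>[OF fg] in \<open>simp_all add: simps(1) W.inv_closed[unfolded simps(1)]\<close>)
    also have "\<dots> = \<iota> (f g)"
      using W.r_inv[of f] W.r_one[of "\<iota> (f g)"] f \<iota>[OF fg] unfolding simps(1) by simp
    finally show ?thesis .
  qed
  have I_sub: "subgroup I ?W" unfolding I_def by (rule h.img_is_subgroup)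
  have I: "I \<lhd> ?W"
    unfolding W.normal_inv_iff
  proof (intro conjI ballI I_sub)
    fix f i assume f: "f \<in> carrier ?W" and i: "i \<in> I"
    then obtain g where g: "g \<in> carrier G" "i = \<iota> g" by (auto simp: I_def)
    have "W.conjg f i \<in> I" using f g conj[of f g] auto_closed[of f g] by (simp add: simps(1) I_def)
    then show "f \<otimes>\<^bsub>?W\<^esub> i \<otimes>\<^bsub>?W\<^esub> inv\<^bsub>?W\<^esub> f \<in> I" by (simp add: W.conjg_def)
  qed
  have "W.p_core_free I"
    unfolding W.p_core_free_def
  proof (intro allI impI)
    fix p :: nat and P assume p: "prime p" and P: "W.p_subgroup p P" "P \<subseteq> I" "\<forall>h\<in>I. W.conjg h ` P \<subseteq> P"
    \<comment> \<open>The preimage of P is a normal p-subgroup of G, its elements having p-power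
      order because \<iota> is injective.\<close>
    define Q where "Q = {g \<in> carrier G. \<iota> g \<in> P}"
    have sP: "subgroup P ?W" using P(1) by (simp add: W.p_subgroup_def)
    have "subgroup Q G"
    proof (rule subgroupI)
      show "Q \<noteq> {}" using sP subgroup.one_closed by (fastforce simp: Q_def)
    next
      fix a assume "a \<in> Q" then show "inv a \<in> Q" using sP by (simp add: Q_def subgroup.m_inv_closed)
    next
      fix a b assume "a \<in> Q" "b \<in> Q" then show "a \<otimes> b \<in> Q" using sP by (simp add: Q_def subgroup.m_closed)
    qed (auto simp: Q_def)
    moreover have "\<exists>k::nat. g [^] (p ^ k) = \<one>" if g: "g \<in> Q" for g
    proof -
      obtain k :: nat where "\<iota> g [^]\<^bsub>?W\<^esub> (p ^ k) = \<one>\<^bsub>?W\<^esub>" using P(1) g by (auto simp: W.p_subgroup_def Q_def)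
      then have "\<iota> (g [^] (p ^ k)) = \<iota> \<one>" using g by (simp add: h.hom_nat_pow Q_def)
      then have "g [^] (p ^ k) = \<one>" using g inj by (simp add: Q_def)
      then show ?thesis ..
    qed
    ultimately have "p_subgroup p Q" by (simp add: p_subgroup_def)
    moreover have "\<forall>h\<in>carrier G. conjg h ` Q \<subseteq> Q"
    proof (intro ballI image_subsetI)
      fix g q assume g: "g \<in> carrier G" and q: "q \<in> Q"
      have "W.conjg (\<iota> g) (\<iota> q) \<in> P" using P(3) g q by (auto simp: I_def Q_def)
      moreover have "W.conjg (\<iota> g) (\<iota> q) = \<iota> (conjg g q)" using conj[OF \<iota>[OF g], of q] q by (simp add: Q_def \<iota>_apply)
      ultimately show "conjg g q \<in> Q" using g q by (simp add: Q_def)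
    qed
    moreover have "Q \<subseteq> carrier G" by (auto simp: Q_def)
    ultimately have "Q = {\<one>}" using core p unfolding p_core_free_def by blast
    moreover have "P \<subseteq> \<iota> ` Q" using P(2) by (auto simp: I_def Q_def)
    ultimately have "P \<subseteq> {\<one>\<^bsub>?W\<^esub>}" by simp
    then show "P = {\<one>\<^bsub>?W\<^esub>}" using subgroup.one_closed[OF sP] by blast
  qed
  moreover have "f = \<one>\<^bsub>?W\<^esub>" if f: "f \<in> carrier ?W" and fi: "\<And>i. i \<in> I \<Longrightarrow> W.conjg f i = i" for f
  proof -
    have "f g = g" if g: "g \<in> carrier G" for g
    proof (rule inj)
      show "\<iota> (f g) = \<iota> g" using fi[of "\<iota> g"] conj[of f g] f g by (simp add: I_def simps(1))
    qed (use f g auto_closed in \<open>auto simp: simps\<close>)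
    moreover have "f \<in> extensional (carrier G)" using f by (auto simp: simps auto_def Bij_def)
    ultimately show ?thesis by (intro extensionalityI[of _ "carrier G"]) (auto simp: simps)
  qed
  moreover have "finite (carrier ?W)"
    using finite_Bij[OF fin] by (rule finite_subset[rotated]) (auto simp: simps auto_def)
  moreover have "I #>\<^bsub>?W\<^esub> \<alpha> = I #>\<^bsub>?W\<^esub> \<beta>"
  proof -
    have ext: "\<alpha> \<in> extensional (carrier G)" using ab by (simp add: auto_def Bij_def)
    have "\<iota> y \<otimes>\<^bsub>?W\<^esub> \<beta> = \<alpha>"
      using ext by (intro extensionalityI[of _ "carrier G"])
        (use ab y \<iota> in \<open>auto simp: simps compose_def \<iota>_apply auto_closed\<close>)
    moreover have "\<iota> y \<in> I" using y by (simp add: I_def)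
    ultimately have "\<alpha> \<in> I #>\<^bsub>?W\<^esub> \<beta>" unfolding r_coset_def by blast
    then have "I #>\<^bsub>?W\<^esub> \<beta> = I #>\<^bsub>?W\<^esub> \<alpha>"
      using ab by (intro W.repr_independence[OF _ _ I_sub]) (simp_all add: simps)
    then show ?thesis by simp
  qed
  moreover have "card I = card (carrier G)" unfolding I_def
    by (rule card_image) (use inj in \<open>auto simp: inj_on_def\<close>)
  ultimately show ?thesis using W.lcm_ord_le_card[OF _ I] ab by (simp add: simps)
qed

section \<open>The largest normal p-subgroup\<close>

text \<open>This is O_p(M) when M is a subgroup. The union is a subgroup because the product of two
  normal p-subgroups is again one.\<close>

definition p_core :: "nat \<Rightarrow> 'a set \<Rightarrow> 'a set"
  where "p_core p M = \<Union> {P. p_subgroup p P \<and> P \<subseteq> M \<and> (\<forall>h\<in>M. conjg h ` P \<subseteq> P)}"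

lemma p_subgroup_p_core:
  assumes M: "subgroup M G"
  shows "p_subgroup p (p_core p M)"
proof -
  let ?S = "{P. p_subgroup p P \<and> P \<subseteq> M \<and> (\<forall>h\<in>M. conjg h ` P \<subseteq> P)}"
  have Mc: "M \<subseteq> carrier G" using M by (rule subgroup.subset)
  have mult: "x \<otimes> y \<in> p_core p M" if xy: "x \<in> p_core p M" "y \<in> p_core p M" for x y
  proof -
    obtain P Q where P: "P \<in> ?S" "x \<in> P" and Q: "Q \<in> ?S" "y \<in> Q" using xy unfolding p_core_def by blast
    have c: "P \<subseteq> carrier G" "Q \<subseteq> carrier G" using P Q p_subgroup_carrier by auto
    have "p_subgroup p (P <#> Q)"
      by (rule p_subgroup_set_mult) (use P Q in blast)+
    moreover have "P <#> Q \<subseteq> M"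
      using P Q M unfolding set_mult_def by (auto intro!: subgroup.m_closed)
    moreover have "conjg h z \<in> P <#> Q" if h: "h \<in> M" and z: "z \<in> P <#> Q" for h z
    proof -
      obtain a b where ab: "a \<in> P" "b \<in> Q" "z = a \<otimes> b" using z by (auto simp: set_mult_def)
      then have "conjg h z = conjg h a \<otimes> conjg h b" using h Mc c by (simp add: conjg_mult subset_iff)
      moreover have "conjg h a \<in> P" "conjg h b \<in> Q" using ab P Q h by blast+
      ultimately show ?thesis unfolding set_mult_def by blast
    qed
    ultimately have "P <#> Q \<in> ?S" by blast
    moreover have "x \<otimes> y \<in> P <#> Q" using P Q unfolding set_mult_def by blast
    ultimately show ?thesis unfolding p_core_def by blast
  qed
  have one: "{\<one>} \<in> ?S" using M Mc
    by (auto simp: p_subgroup_def triv_subgroup subgroup.one_closed subset_iff)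
  have "subgroup (p_core p M) G"
  proof (rule subgroupI)
    show "p_core p M \<subseteq> carrier G" using Mc unfolding p_core_def by blast
    show "p_core p M \<noteq> {}" using one unfolding p_core_def by blast
  next
    fix a assume "a \<in> p_core p M"
    then obtain P where P: "P \<in> ?S" "a \<in> P" unfolding p_core_def by blast
    then have "inv a \<in> P" by (simp add: p_subgroup_def subgroup.m_inv_closed)
    then show "inv a \<in> p_core p M" using P unfolding p_core_def by blast
  qed (rule mult)
  then show ?thesis unfolding p_subgroup_def p_core_def by auto
qed

lemma p_core_subset: "p_core p M \<subseteq> M"
  by (auto simp: p_core_def)

lemma hom_conjg:
  assumes "f \<in> hom G G" "g \<in> carrier G" "x \<in> carrier G"
  shows "f (conjg g x) = conjg (f g) (f x)"
proof -
  interpret f: group_hom G G f using assms by unfold_locales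
  show ?thesis using assms by (simp add: conjg_def)
qed

lemma p_core_image:
  assumes f: "f \<in> hom G G" and fM: "f ` M = M" and M: "subgroup M G"
  shows "f ` p_core p M \<subseteq> p_core p M"
proof
  interpret f: group_hom G G f using f by unfold_locales
  fix y assume "y \<in> f ` p_core p M"
  then obtain x where x: "x \<in> p_core p M" "y = f x" by blast
  then obtain P where P: "p_subgroup p P" "P \<subseteq> M" "\<forall>h\<in>M. conjg h ` P \<subseteq> P" "x \<in> P"
    unfolding p_core_def by blast
  have Pc: "P \<subseteq> carrier G" using P(1) by (rule p_subgroup_carrier)
  have Mc: "M \<subseteq> carrier G" using M by (rule subgroup.subset)
  have "subgroup (f ` P) G" using P(1) by (intro f.subgroup_img_is_subgroup) (simp add: p_subgroup_def)
  moreover have "\<exists>k::nat. f u [^] (p ^ k) = \<one>" if u: "u \<in> P" for u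
  proof -
    obtain k :: nat where k: "u [^] (p ^ k) = \<one>" using P(1) u by (auto simp: p_subgroup_def)
    have "f u [^] (p ^ k) = f (u [^] (p ^ k))" using u Pc by (simp add: f.hom_nat_pow subset_iff)
    then have "f u [^] (p ^ k) = \<one>" using k by simp
    then show ?thesis ..
  qed
  ultimately have "p_subgroup p (f ` P)" by (simp add: p_subgroup_def)
  moreover have "f ` P \<subseteq> M" using P(2) fM by blast
  moreover have "conjg h (f u) \<in> f ` P" if h: "h \<in> M" and u: "u \<in> P" for h u
  proof -
    obtain g where g: "g \<in> M" "h = f g" using h fM by blast
    have "conjg h (f u) = f (conjg g u)" unfolding g(2)
      by (rule hom_conjg[OF f, symmetric]) (use g u Mc Pc in auto)
    moreover have "conjg g u \<in> P" using P(3) g u by blast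
    ultimately show ?thesis by simp
  qed
  then have "\<forall>h\<in>M. conjg h ` f ` P \<subseteq> f ` P" by auto
  ultimately have "f ` P \<in> {P. p_subgroup p P \<and> P \<subseteq> M \<and> (\<forall>h\<in>M. conjg h ` P \<subseteq> P)}" by simp
  then show "y \<in> p_core p M" unfolding p_core_def x(2) by (rule UnionI) (use P(4) in simp)
qed

section \<open>Affine maps with a given linear part\<close>

text \<open>Equivalent to b g = b \<one> \<otimes> \<beta> g on the carrier, with the translation
  part left implicit: iterates of b then pair with iterates of \<beta>, and induced maps on cosets
  are plain images. Values off the carrier stay free, in contrast to members of
  \<open>BijGroup\<close>.\<close>

definition affine_with :: "('a \<Rightarrow> 'a) \<Rightarrow> ('a \<Rightarrow> 'a) \<Rightarrow> bool"
  where "affine_with b \<beta> \<longleftrightarrow> \<beta> \<in> hom G G \<and> inj_on \<beta> (carrier G) \<and> (\<forall>g\<in>carrier G. b g \<in> carrier G) \<and>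
    (\<forall>g\<in>carrier G. \<forall>h\<in>carrier G. b (g \<otimes> h) = b g \<otimes> \<beta> h)"

lemma affine_withD:
  assumes "affine_with b \<beta>"
  shows "\<beta> \<in> hom G G" "inj_on \<beta> (carrier G)" "g \<in> carrier G \<Longrightarrow> b g \<in> carrier G"
    "g \<in> carrier G \<Longrightarrow> \<beta> g \<in> carrier G"
    "\<lbrakk>g \<in> carrier G; h \<in> carrier G\<rbrakk> \<Longrightarrow> b (g \<otimes> h) = b g \<otimes> \<beta> h"
    "\<lbrakk>g \<in> carrier G; h \<in> carrier G\<rbrakk> \<Longrightarrow> \<beta> (g \<otimes> h) = \<beta> g \<otimes> \<beta> h"
  using assms by (auto simp: affine_with_def hom_def)

lemma affine_with_funpow:
  assumes "affine_with b \<beta>"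
  shows "affine_with (b ^^ n) (\<beta> ^^ n)"
proof (induction n)
  case 0
  then show ?case by (simp add: affine_with_def hom_def)
next
  case (Suc n)
  note A = affine_withD[OF assms] and B = affine_withD[OF Suc]
  have "inj_on (\<beta> \<circ> \<beta> ^^ n) (carrier G)"
  proof (rule comp_inj_on[OF B(2)])
    show "inj_on \<beta> ((\<beta> ^^ n) ` carrier G)" by (rule inj_on_subset[OF A(2)]) (use B(4) in blast)
  qed
  moreover have "\<beta> \<circ> \<beta> ^^ n \<in> hom G G"
  proof (rule homI)
    fix x y assume "x \<in> carrier G" "y \<in> carrier G"
    then show "(\<beta> \<circ> \<beta> ^^ n) (x \<otimes> y) = (\<beta> \<circ> \<beta> ^^ n) x \<otimes> (\<beta> \<circ> \<beta> ^^ n) y"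
      using A(6)[OF B(4) B(4), of x y] B(6)[of x y] by simp
  qed (use A(4)[OF B(4)] in simp)
  moreover have "(b \<circ> b ^^ n) g \<in> carrier G" if "g \<in> carrier G" for g
    using A(3)[OF B(3)[OF that]] by simp
  moreover have "(b \<circ> b ^^ n) (g \<otimes> h) = (b \<circ> b ^^ n) g \<otimes> (\<beta> \<circ> \<beta> ^^ n) h"
    if "g \<in> carrier G" "h \<in> carrier G" for g h
    using A(5)[OF B(3)[OF that(1)] B(4)[OF that(2)]] B(5)[OF that] by simp
  ultimately show ?case unfolding affine_with_def funpow.simps by blast
qed

text \<open>The condition \<open>inv g \<otimes> b g \<in> M\<close> expresses that b preserves the
  left coset gM. The displacement of an iterate telescopes into a product of single
  displacements.\<close>

lemma affine_with_trivial_mod_funpow: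
  assumes b: "affine_with b \<beta>" and M: "subgroup M G"
    and triv: "\<And>g. g \<in> carrier G \<Longrightarrow> inv g \<otimes> b g \<in> M" and g: "g \<in> carrier G"
  shows "inv g \<otimes> (b ^^ n) g \<in> M"
proof (induction n)
  case 0
  then show ?case using M g by (simp add: subgroup.one_closed)
next
  case (Suc n)
  have c: "(b ^^ n) g \<in> carrier G" using affine_withD(3)[OF affine_with_funpow[OF b]] g .
  then have c': "b ((b ^^ n) g) \<in> carrier G" using affine_withD(3)[OF b] by blast
  have "(inv g \<otimes> (b ^^ n) g) \<otimes> (inv ((b ^^ n) g) \<otimes> b ((b ^^ n) g)) \<in> M"
    using Suc triv[OF c] M by (simp add: subgroup.m_closed)
  also have "(inv g \<otimes> (b ^^ n) g) \<otimes> (inv ((b ^^ n) g) \<otimes> b ((b ^^ n) g)) = inv g \<otimes> b ((b ^^ n) g)"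
  proof -
    have "(b ^^ n) g \<otimes> (inv ((b ^^ n) g) \<otimes> b ((b ^^ n) g)) = b ((b ^^ n) g)"
      using c c' by (simp flip: m_assoc)
    then show ?thesis using g c c' by (simp add: m_assoc)
  qed
  finally show ?case by simp
qed

lemma affine_with_linear_part:
  assumes b: "affine_with b \<beta>" and g: "g \<in> carrier G"
  shows "\<beta> g = inv (b \<one>) \<otimes> b g"
proof -
  note A = affine_withD[OF b]
  have "b g = b \<one> \<otimes> \<beta> g" using A(5)[of \<one> g] g by simp
  moreover have "inv (b \<one>) \<otimes> (b \<one> \<otimes> \<beta> g) = \<beta> g" using A(3)[of \<one>] A(4)[OF g] by (simp flip: m_assoc)
  ultimately show ?thesis by simp
qed

lemma affine_with_image_subgroup:
  assumes b: "affine_with b \<beta>" and M: "subgroup M G"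
    and triv: "\<And>g. g \<in> carrier G \<Longrightarrow> inv g \<otimes> b g \<in> M"
  shows "\<beta> ` M \<subseteq> M"
proof
  note A = affine_withD[OF b]
  have Mc: "M \<subseteq> carrier G" using M by (rule subgroup.subset)
  fix y assume "y \<in> \<beta> ` M"
  then obtain x where x: "x \<in> M" "y = \<beta> x" by blast
  then have xc: "x \<in> carrier G" using Mc by auto
  have bx: "b x \<in> M"
  proof -
    have "x \<otimes> (inv x \<otimes> b x) \<in> M" using triv[OF xc] x M by (simp add: subgroup.m_closed)
    then show ?thesis using xc A(3)[OF xc] by (simp flip: m_assoc)
  qed
  have "b \<one> \<in> M" using triv[of \<one>] A(3)[of \<one>] by simp
  then show "y \<in> M" using affine_with_linear_part[OF b xc] bx M x by (simp add: subgroup.m_closed subgroup.m_inv_closed)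
qed

text \<open>Both b(1) and the displacement of g lie in M, so \<beta> g = w \<otimes> g with w in M,
  and conjugation by w is trivial on the abelian M. Thus \<beta> commutes on M with the conjugation
  action of G.\<close>

lemma affine_with_conjg_abelian:
  assumes b: "affine_with b \<beta>" and M: "M \<lhd> G" and comm: "\<And>x y. \<lbrakk>x \<in> M; y \<in> M\<rbrakk> \<Longrightarrow> x \<otimes> y = y \<otimes> x"
    and triv: "\<And>g. g \<in> carrier G \<Longrightarrow> inv g \<otimes> b g \<in> M" and g: "g \<in> carrier G" and n: "n \<in> M"
  shows "\<beta> (conjg g n) = conjg g (\<beta> n)"
proof -
  interpret M: normal M G by (rule M)
  note A = affine_withD[OF b]
  have nc: "n \<in> carrier G" using n by simp
  have bn: "\<beta> n \<in> M" using affine_with_image_subgroup[OF b M.subgroup_axioms triv] n by blast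
  have b1: "b \<one> \<in> M" using triv[of \<one>] A(3)[of \<one>] by simp
  define w where "w = inv (b \<one>) \<otimes> conjg g (inv g \<otimes> b g)"
  have w: "w \<in> M" unfolding w_def using b1 M.inv_op_closed2[OF g triv[OF g]] by (simp add: conjg_def)
  have "g \<otimes> (inv g \<otimes> b g) = b g" using g A(3)[OF g] by (simp flip: m_assoc)
  then have "\<beta> g = w \<otimes> g" unfolding affine_with_linear_part[OF b g] w_def
    using g b1 A(3)[OF g] by (simp add: conjg_def m_assoc)
  moreover have "\<beta> (conjg g n) = conjg (\<beta> g) (\<beta> n)" using A(1) g nc by (rule hom_conjg)
  ultimately have "\<beta> (conjg g n) = conjg w (conjg g (\<beta> n))" using w g bn by (simp add: conjg_conj)
  moreover have "conjg g (\<beta> n) \<in> M" using M.inv_op_closed2[OF g bn] by (simp add: conjg_def)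
  then have "conjg w (conjg g (\<beta> n)) = conjg g (\<beta> n)"
    using comm[OF w] w by (subst conjg_eq_self_iff) simp_all
  ultimately show ?thesis by simp
qed

end

section \<open>Affine maps preserving the cosets of a normal subgroup\<close>

lemma funpow_restrict:
  assumes "f ` S \<subseteq> S" "x \<in> S"
  shows "(restrict f S ^^ n) x = (f ^^ n) x \<and> (f ^^ n) x \<in> S"
  by (induction n) (use assms in auto)

text \<open>Gives linear parts, which need not be extensional or map only S to itself, an order on
  S; on a finite set injectivity yields the bijection.\<close>

lemma ord_restrict:
  assumes fin: "finite S" and f: "f ` S \<subseteq> S" "inj_on f S"
  shows "restrict f S \<in> Bij S"
    and "group.ord (BijGroup S) (restrict f S) > 0"
    and "group.ord (BijGroup S) (restrict f S) dvd n \<longleftrightarrow> (\<forall>x\<in>S. (f ^^ n) x = x)"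
proof -
  interpret group "BijGroup S" by (rule group_BijGroup)
  have "f ` S = S" using fin f by (rule endo_inj_surj)
  then have "bij_betw f S S" using f(2) by (simp add: bij_betw_def)
  then show B: "restrict f S \<in> Bij S" by (simp add: Bij_def)
  show "ord (restrict f S) > 0"
    using ord_ge_1[of "restrict f S"] finite_Bij[OF fin] B by (simp add: BijGroup_def)
  show "ord (restrict f S) dvd n \<longleftrightarrow> (\<forall>x\<in>S. (f ^^ n) x = x)"
    unfolding BijGroup_ord_dvd_iff[OF B] using funpow_restrict[OF f(1)] by simp
qed

context group
begin

lemma normal_conjg_iff: "N \<lhd> G \<longleftrightarrow> subgroup N G \<and> (\<forall>g\<in>carrier G. \<forall>n\<in>N. conjg g n \<in> N)"
  by (simp add: normal_inv_iff conjg_def)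

lemma period_le_card_abelian:
  assumes fin: "finite (carrier G)" and b: "affine_with b \<beta>" and M: "M \<lhd> G"
    and triv: "\<And>g. g \<in> carrier G \<Longrightarrow> inv g \<otimes> b g \<in> M"
    and minimal: "\<And>Q. \<lbrakk>Q \<lhd> G; Q \<subseteq> M; \<beta> ` Q \<subseteq> Q\<rbrakk> \<Longrightarrow> Q = {\<one>} \<or> Q = M"
    and comm: "\<And>x y. \<lbrakk>x \<in> M; y \<in> M\<rbrakk> \<Longrightarrow> x \<otimes> y = y \<otimes> x"
  shows "\<exists>l. 0 < l \<and> l \<le> card M \<and> (\<forall>g\<in>carrier G. (b ^^ l) g = g)"
proof -
  interpret M: normal M G by (rule M)
  have sM: "subgroup M G" by (rule M.subgroup_axioms)
  note A = affine_withD[OF b]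
  have finM: "finite M" using M.subset fin by (rule finite_subset)
  have cardM: "card M > 0" using finM subgroup.one_closed[OF sM] card_gt_0_iff by blast
  have \<beta>M: "\<beta> ` M \<subseteq> M" using affine_with_image_subgroup[OF b sM triv] .
  have inj: "inj_on \<beta> M" using A(2) M.subset by (rule inj_on_subset)
  \<comment> \<open>Since iterates of \<beta> commute with conjugation on M, their fixed points in M
    form a normal subgroup of G. It is \<beta>-invariant, so minimality leaves only 1 and M.\<close>
  define F where "F k = {n \<in> M. (\<beta> ^^ k) n = n}" for k
  have F: "F k = {\<one>} \<or> F k = M" for k
  proof (rule minimal)
    note Ak = affine_withD[OF affine_with_funpow[OF b, of k]]
    interpret h: group_hom G G "\<beta> ^^ k" using Ak(1) by unfold_locales
    have "\<one> \<in> F k" by (simp add: F_def)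
    then have ne: "F k \<noteq> {}" by blast
    have "subgroup (F k) G" by (rule subgroupI[OF _ ne]) (auto simp: F_def h.hom_inv)
    moreover have "conjg g n \<in> F k" if g: "g \<in> carrier G" and n: "n \<in> F k" for g n
    proof -
      have nM: "n \<in> M" "(\<beta> ^^ k) n = n" using n by (simp_all add: F_def)
      have "(\<beta> ^^ k) (conjg g n) = conjg g ((\<beta> ^^ k) n)"
        by (rule affine_with_conjg_abelian[OF affine_with_funpow[OF b] M comm
              affine_with_trivial_mod_funpow[OF b sM triv] g nM(1)])
      moreover have "conjg g n \<in> M" using M.inv_op_closed2[OF g nM(1)] by (simp add: conjg_def)
      ultimately show ?thesis using nM by (simp add: F_def)
    qed
    ultimately show "F k \<lhd> G" unfolding normal_conjg_iff by blast
    show "F k \<subseteq> M" by (auto simp: F_def)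
    show "\<beta> ` F k \<subseteq> F k"
    proof (rule image_subsetI)
      fix n assume n: "n \<in> F k"
      then have "(\<beta> ^^ k) (\<beta> n) = \<beta> n" using funpow_swap1[of \<beta> k n] by (simp add: F_def)
      then show "\<beta> n \<in> F k" using n \<beta>M by (auto simp: F_def)
    qed
  qed
  show ?thesis
  proof (cases "F 1 = M")
    case True
    then have \<beta>: "\<beta> n = n" if "n \<in> M" for n using that by (auto simp: F_def)
    have "(b ^^ card M) g = g" if g: "g \<in> carrier G" for g
    proof -
      define x where "x = inv g \<otimes> b g"
      have x: "x \<in> M" using triv[OF g] by (simp add: x_def)
      have bg: "b g = g \<otimes> x" unfolding x_def using g A(3)[OF g] by (simp flip: m_assoc)
      have pow: "x [^] k \<in> M" for k :: nat using sM x by (rule subgroup_nat_pow_closed)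
      \<comment> \<open>As \<beta> fixes every power of x, each application of b contributes one
        more factor x.\<close>
      have "(b ^^ k) g = g \<otimes> x [^] k" for k
      proof (induction k)
        case 0
        show ?case using g by simp
      next
        case (Suc k)
        have xc: "x \<in> carrier G" using x by simp
        have "(b ^^ Suc k) g = b (g \<otimes> x [^] k)" using Suc by simp
        also have "\<dots> = b g \<otimes> x [^] k" using A(5)[of g "x [^] k"] g xc \<beta>[OF pow] by simp
        also have "\<dots> = g \<otimes> (x \<otimes> x [^] k)" using bg g xc by (simp add: m_assoc)
        also have "x \<otimes> x [^] k = x [^] Suc k" using nat_pow_Suc2[OF xc] by simp
        finally show ?case .
      qed
      moreover have "x [^] card M = \<one>"
      proof -
        interpret K: group "G\<lparr>carrier := M\<rparr>" using sM by (rule subgroup_imp_group)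
        have "x [^]\<^bsub>G\<lparr>carrier := M\<rparr>\<^esub> order (G\<lparr>carrier := M\<rparr>) = \<one>"
          using K.pow_order_eq_1[of x] x by simp
        then show ?thesis by (simp add: order_def flip: nat_pow_consistent)
      qed
      ultimately show ?thesis using g by simp
    qed
    then show ?thesis using cardM by blast
  next
    case False
    then have F1: "F 1 = {\<one>}" using F[of 1] by blast
    have "M \<noteq> {\<one>}" using False F1 by auto
    then obtain v where v: "v \<in> M" "v \<noteq> \<one>" using subgroup.one_closed[OF sM] by blast
    define m where "m = group.ord (BijGroup M) (restrict \<beta> M)"
    have m0: "m > 0" unfolding m_def by (rule ord_restrict[OF finM \<beta>M inj])
    have m: "m dvd n \<longleftrightarrow> (\<forall>x\<in>M. (\<beta> ^^ n) x = x)" for n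
      unfolding m_def by (rule ord_restrict[OF finM \<beta>M inj])
    \<comment> \<open>An early repetition in the orbit of v would make some power of \<beta> with
      exponent below m fix v, which is not 1; that power would then be trivial on all of M, against
      the choice of m.\<close>
    have "inj_on (\<lambda>i. (\<beta> ^^ i) v) {..<m}"
    proof (rule linorder_inj_onI)
      fix i j assume ij: "i < j" "i \<in> {..<m}" "j \<in> {..<m}"
      show "(\<beta> ^^ i) v \<noteq> (\<beta> ^^ j) v"
      proof
        assume eq: "(\<beta> ^^ i) v = (\<beta> ^^ j) v"
        note Ai = affine_withD[OF affine_with_funpow[OF b, of i]]
          and Ad = affine_withD[OF affine_with_funpow[OF b, of "j - i"]]
        have "(\<beta> ^^ j) v = (\<beta> ^^ i) ((\<beta> ^^ (j - i)) v)" using ij funpow_add[of i "j - i" \<beta>] by simp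
        with eq have "(\<beta> ^^ i) ((\<beta> ^^ (j - i)) v) = (\<beta> ^^ i) v" by (simp only:)
        then have "(\<beta> ^^ (j - i)) v = v" by (rule inj_onD[OF Ai(2)]) (use Ad(4) v(1) in simp_all)
        then have "v \<in> F (j - i)" using v(1) by (simp add: F_def)
        then have "F (j - i) \<noteq> {\<one>}" using v(2) by blast
        then have "F (j - i) = M" using F[of "j - i"] by (simp only: simp_thms)
        then have "\<forall>x\<in>M. (\<beta> ^^ (j - i)) x = x" unfolding F_def by blast
        then have "m dvd j - i" unfolding m .
        then show False using ij by (auto dest: dvd_imp_le)
      qed
    qed auto
    moreover have "(\<lambda>i. (\<beta> ^^ i) v) ` {..<m} \<subseteq> M" using funpow_restrict[OF \<beta>M v(1)] by auto
    ultimately have "card {..<m} \<le> card M" using finM by (rule card_inj_on_le)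
    moreover have "(b ^^ m) g = g" if g: "g \<in> carrier G" for g
    proof -
      note Am = affine_withD[OF affine_with_funpow[OF b, of m]]
      define x where "x = inv g \<otimes> b g"
      define z where "z = inv g \<otimes> (b ^^ m) g"
      have x: "x \<in> M" using triv[OF g] by (simp add: x_def)
      have z: "z \<in> M" unfolding z_def by (rule affine_with_trivial_mod_funpow[OF b sM triv g])
      have c: "x \<in> carrier G" "z \<in> carrier G" "\<beta> z \<in> carrier G" using x z A(4) by auto
      have bg: "b g = g \<otimes> x" unfolding x_def using g A(3)[OF g] by (simp flip: m_assoc)
      have bmg: "(b ^^ m) g = g \<otimes> z" unfolding z_def using g Am(3)[OF g] by (simp flip: m_assoc)
      \<comment> \<open>Computing b^(m+1) at g in both orders, with \<beta>^m trivial on the abelian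
        M, gives \<beta> z = z. As \<open>F 1\<close> is trivial, z = 1.\<close>
      have "g \<otimes> (x \<otimes> \<beta> z) = b ((b ^^ m) g)" using A(5)[OF g c(2)] bg bmg g c by (simp add: m_assoc)
      also have "\<dots> = (b ^^ m) (b g)" by (rule funpow_swap1)
      also have "\<dots> = g \<otimes> z \<otimes> (\<beta> ^^ m) x" using Am(5)[OF g c(1)] bg bmg by simp
      also have "(\<beta> ^^ m) x = x" using m[of m] x by auto
      also have "g \<otimes> z \<otimes> x = g \<otimes> (x \<otimes> z)" using comm[OF z x] g c by (simp add: m_assoc)
      finally have "\<beta> z = z" using g c by simp
      then have "z \<in> F 1" using z by (simp add: F_def)
      then show ?thesis using F1 bmg g by simp
    qed
    ultimately show ?thesis using m0 by auto
  qed
qed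

text \<open>The centre Z and each \<open>p_core p M\<close> are normal in G and \<beta>-invariant,
  so each is 1 or M. Z is not M as u and v do not commute, and \<open>p_core p M\<close> is not M
  since a nontrivial p-group has a nontrivial centre. This supplies the hypotheses of
  \<open>lcm_ord_auto_le\<close>.\<close>

lemma period_le_card_nonabelian:
  assumes fin: "finite (carrier G)" and b: "affine_with b \<beta>" and M: "M \<lhd> G"
    and triv: "\<And>g. g \<in> carrier G \<Longrightarrow> inv g \<otimes> b g \<in> M"
    and minimal: "\<And>Q. \<lbrakk>Q \<lhd> G; Q \<subseteq> M; \<beta> ` Q \<subseteq> Q\<rbrakk> \<Longrightarrow> Q = {\<one>} \<or> Q = M"
    and noncomm: "u \<in> M" "v \<in> M" "u \<otimes> v \<noteq> v \<otimes> u"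
  shows "\<exists>l. 0 < l \<and> l \<le> card M \<and> (\<forall>g\<in>carrier G. (b ^^ l) g = g)"
proof -
  interpret M: normal M G by (rule M)
  have sM: "subgroup M G" by (rule M.subgroup_axioms)
  note A = affine_withD[OF b]
  have finM: "finite M" using M.subset fin by (rule finite_subset)
  have \<beta>M_sub: "\<beta> ` M \<subseteq> M" using affine_with_image_subgroup[OF b sM triv] .
  have inj: "inj_on \<beta> M" using A(2) M.subset by (rule inj_on_subset)
  have \<beta>M: "\<beta> ` M = M" using finM \<beta>M_sub inj by (rule endo_inj_surj)
  have conjgM: "conjg g n \<in> M" if "g \<in> carrier G" "n \<in> M" for g n
    using M.inv_op_closed2[OF that] by (simp add: conjg_def)
  have conjgM_image: "conjg g ` M = M" if g: "g \<in> carrier G" for g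
    by (rule conjg_image_subset_imp_eq[OF g finM M.subset]) (use g conjgM in blast)
  define Z where "Z = {z \<in> M. \<forall>n\<in>M. conjg n z = z}"
  have "Z = {\<one>} \<or> Z = M"
  proof (rule minimal)
    have "\<one> \<in> Z" by (simp add: Z_def)
    then have ne: "Z \<noteq> {}" by blast
    have "subgroup (Z) G" by (rule subgroupI[OF _ ne]) (auto simp: Z_def conjg_mult conjg_inv)
    moreover have "conjg g z \<in> Z" if g: "g \<in> carrier G" and z: "z \<in> Z" for g z
    proof -
      have zM: "z \<in> M" and zc: "z \<in> carrier G" using z by (auto simp: Z_def)
      have "conjg n (conjg g z) = conjg g z" if n: "n \<in> M" for n
      proof -
        obtain k where k: "k \<in> M" "n = conjg g k" using n conjgM_image[OF g] by blast
        have "conjg n (conjg g z) = conjg g (conjg k z)"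
          unfolding k(2) using hom_conjg[OF conjg_in_hom[OF g], of k z] k(1) zc by simp
        then show ?thesis using z k(1) by (simp add: Z_def)
      qed
      then show ?thesis using conjgM[OF g zM] by (simp add: Z_def)
    qed
    ultimately show "Z \<lhd> G" unfolding normal_conjg_iff by blast
    show "Z \<subseteq> M" by (auto simp: Z_def)
    show "\<beta> ` Z \<subseteq> Z"
    proof (rule image_subsetI)
      fix z assume z: "z \<in> Z"
      have zM: "z \<in> M" and zc: "z \<in> carrier G" using z by (auto simp: Z_def)
      have "conjg n (\<beta> z) = \<beta> z" if n: "n \<in> M" for n
      proof -
        obtain k where k: "k \<in> M" "n = \<beta> k" using n \<beta>M by blast
        have "conjg n (\<beta> z) = \<beta> (conjg k z)" unfolding k(2) using hom_conjg[OF A(1), of k z] k(1) zc by simp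
        then show ?thesis using z k(1) by (simp add: Z_def)
      qed
      then show "\<beta> z \<in> Z" using zM \<beta>M_sub by (auto simp: Z_def)
    qed
  qed
  moreover have "v \<notin> Z" using noncomm conjg_eq_self_iff[of u v] by (auto simp: Z_def)
  ultimately have Z: "Z = {\<one>}" using noncomm by blast
  have core: "p_core p M = {\<one>}" if p: "prime p" for p
  proof -
    have sC: "subgroup (p_core p M) G" using p_subgroup_p_core[OF sM] by (simp add: p_subgroup_def)
    have "p_core p M = {\<one>} \<or> p_core p M = M"
    proof (rule minimal)
      have "conjg g n \<in> p_core p M" if "g \<in> carrier G" "n \<in> p_core p M" for g n
        using p_core_image[OF conjg_in_hom[OF that(1)] conjgM_image[OF that(1)] sM] that(2) by blast
      then show "p_core p M \<lhd> G" unfolding normal_conjg_iff using sC by blast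
      show "p_core p M \<subseteq> M" by (rule p_core_subset)
      show "\<beta> ` p_core p M \<subseteq> p_core p M" using A(1) \<beta>M sM by (rule p_core_image)
    qed
    moreover have "p_core p M \<noteq> M"
    proof
      assume "p_core p M = M"
      then have pM: "p_subgroup p M" using p_subgroup_p_core[OF sM, of p] by simp
      have "M \<noteq> {\<one>}" using noncomm by auto
      then obtain z where z: "z \<in> M" "z \<noteq> \<one>" "\<And>x. x \<in> M \<Longrightarrow> x \<otimes> z = z \<otimes> x"
        using p_subgroup_center[OF pM finM p] by metis
      then have "z \<in> Z" by (auto simp: Z_def conjg_eq_self_iff)
      then show False using Z z(2) by blast
    qed
    ultimately show ?thesis by blast
  qed
  \<comment> \<open>M is made a group of its own so that the bound can be applied to its
    automorphisms.\<close>
  define K where "K = G\<lparr>carrier := M\<rparr>"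
  interpret K: group K unfolding K_def using sM by (rule subgroup_imp_group)
  have K_simps: "carrier K = M" "\<one>\<^bsub>K\<^esub> = \<one>" "x \<otimes>\<^bsub>K\<^esub> y = x \<otimes> y" for x y by (simp_all add: K_def)
  have K_conjg: "K.conjg g x = conjg g x" if "g \<in> M" for g x
    unfolding K.conjg_def conjg_def using that m_inv_consistent[OF sM] by (simp add: K_def)
  have K_pow: "x [^]\<^bsub>K\<^esub> (n::nat) = x [^] n" for x n by (simp add: K_def flip: nat_pow_consistent)
  have "K.p_core_free (carrier K)"
    unfolding K.p_core_free_def
  proof (intro allI impI)
    fix p :: nat and P assume p: "prime p" and P: "K.p_subgroup p P" "P \<subseteq> carrier K" "\<forall>h\<in>carrier K. K.conjg h ` P \<subseteq> P"
    have sPK: "subgroup P K" using P(1) by (simp add: K.p_subgroup_def)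
    then have sP: "subgroup P G" unfolding K_def by (rule incl_subgroup[OF sM])
    have "p_subgroup p P" using P(1) sP by (simp add: p_subgroup_def K.p_subgroup_def K_pow K_simps)
    moreover have "\<forall>h\<in>M. conjg h ` P \<subseteq> P" using P(3) K_conjg unfolding K_simps by simp
    ultimately have "P \<subseteq> p_core p M" using P(2) unfolding p_core_def K_simps by blast
    then show "P = {\<one>\<^bsub>K\<^esub>}" using core[OF p] subgroup.one_closed[OF sP] by (auto simp: K_simps)
  qed
  moreover have "z = \<one>\<^bsub>K\<^esub>" if z: "z \<in> carrier K" and x: "\<And>x. x \<in> carrier K \<Longrightarrow> K.conjg z x = x" for z
  proof -
    have zM: "z \<in> M" using z by (simp add: K_simps)
    have "conjg n z = z" if n: "n \<in> M" for n
    proof -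
      have "conjg z n = n" using x[of n] n K_conjg[OF zM] by (simp add: K_simps)
      then show ?thesis using zM n by (simp add: conjg_eq_self_iff)
    qed
    then have "z \<in> Z" using zM by (simp add: Z_def)
    then show ?thesis using Z by (simp add: K_simps)
  qed
  moreover define y where "y = b \<one>"
  \<comment> \<open>Pulling a factor n of M out on the left of b(n h) conjugates \<beta>(n) by the
    translation part y. This is the automorphism that differs from \<beta> by an inner one.\<close>
  define \<kappa> where "\<kappa> = (\<lambda>n. conjg y (\<beta> n))"
  have yM: "y \<in> M" unfolding y_def using triv[of \<one>] A(3)[of \<one>] by simp
  have \<kappa>M: "\<kappa> ` M \<subseteq> M" using yM \<beta>M_sub subgroup_conjg_closed[OF sM] by (auto simp: \<kappa>_def)
  have inj\<kappa>: "inj_on \<kappa> M"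
  proof -
    have "inj_on (conjg y) (\<beta> ` M)" unfolding \<beta>M by (rule conjg_inj_on) (use yM M.subset in auto)
    then show ?thesis using comp_inj_on[OF inj] by (simp add: \<kappa>_def comp_def)
  qed
  have auto_restrict: "restrict f M \<in> auto K"
    if "f ` M \<subseteq> M" "inj_on f M" "\<And>x y. \<lbrakk>x \<in> M; y \<in> M\<rbrakk> \<Longrightarrow> f (x \<otimes> y) = f x \<otimes> f y" for f
    using ord_restrict(1)[OF finM that(1,2)] that by (auto simp: auto_def hom_def K_simps)
  have \<beta>_auto: "restrict \<beta> M \<in> auto K" using A(6) by (intro auto_restrict \<beta>M_sub inj) simp
  have \<kappa>_auto: "restrict \<kappa> M \<in> auto K"
    using A(4,6) yM by (intro auto_restrict \<kappa>M inj\<kappa>) (simp add: \<kappa>_def conjg_mult)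
  define l where "l = lcm (group.ord (BijGroup M) (restrict \<kappa> M)) (group.ord (BijGroup M) (restrict \<beta> M))"
  moreover have "restrict \<kappa> M n = K.conjg y (restrict \<beta> M n)" if "n \<in> M" for n
    using that K_conjg[OF yM] by (simp add: \<kappa>_def)
  ultimately have "l \<le> card M"
    using K.lcm_ord_auto_le[OF _ _ _ \<kappa>_auto \<beta>_auto, of y] finM yM
      K.ord_AutoGroup[OF \<kappa>_auto] K.ord_AutoGroup[OF \<beta>_auto] by (simp add: K_simps)
  moreover have "l > 0"
    unfolding l_def using ord_restrict(2)[OF finM \<kappa>M inj\<kappa>] ord_restrict(2)[OF finM \<beta>M_sub inj]
    by (simp add: lcm_pos_nat)
  moreover have "(b ^^ l) g = g" if g: "g \<in> carrier G" for g
  proof -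
    have \<beta>l: "(\<beta> ^^ l) n = n" if "n \<in> M" for n
      using ord_restrict(3)[OF finM \<beta>M_sub inj, of l] that by (simp add: l_def)
    have \<kappa>l: "(\<kappa> ^^ l) n = n" if "n \<in> M" for n
      using ord_restrict(3)[OF finM \<kappa>M inj\<kappa>, of l] that by (simp add: l_def)
    have left: "b (n \<otimes> h) = \<kappa> n \<otimes> b h" if n: "n \<in> M" and h: "h \<in> carrier G" for n h
    proof -
      have c: "n \<in> carrier G" "y \<in> carrier G" "\<beta> n \<in> carrier G" "\<beta> h \<in> carrier G" using n yM h A(4) by auto
      have bh: "b h = y \<otimes> \<beta> h" using A(5)[of \<one> h] h by (simp add: y_def)
      have "b (n \<otimes> h) = y \<otimes> (\<beta> n \<otimes> \<beta> h)" using A(5)[of \<one> "n \<otimes> h"] A(6)[of n h] h c by (simp add: y_def)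
      also have "\<dots> = \<kappa> n \<otimes> (y \<otimes> \<beta> h)"
      proof -
        have "inv y \<otimes> (y \<otimes> \<beta> h) = \<beta> h" using c by (simp flip: m_assoc)
        then show ?thesis unfolding \<kappa>_def conjg_def using c by (simp add: m_assoc)
      qed
      finally show ?thesis using bh by simp
    qed
    have left_pow: "(b ^^ k) (n \<otimes> g) = (\<kappa> ^^ k) n \<otimes> (b ^^ k) g" if n: "n \<in> M" for n k
    proof (induction k)
      case (Suc k)
      have "(\<kappa> ^^ k) n \<in> M" using funpow_restrict[OF \<kappa>M n] by blast
      then show ?case using left[of "(\<kappa> ^^ k) n" "(b ^^ k) g"] Suc affine_withD(3)[OF affine_with_funpow[OF b] g] by simp
    qed simp
    note Al = affine_withD[OF affine_with_funpow[OF b, of l]]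
    define w where "w = inv g \<otimes> (b ^^ l) g"
    have w: "w \<in> M" unfolding w_def by (rule affine_with_trivial_mod_funpow[OF b sM triv g])
    have blg: "(b ^^ l) g = g \<otimes> w" unfolding w_def using g Al(3)[OF g] by (simp flip: m_assoc)
    \<comment> \<open>Here b^l(g n) is computed twice: directly with \<beta>^l, and with \<kappa>^l
      after rewriting g n as \<open>conjg g n \<otimes> g\<close>. So w centralises M.\<close>
    have "conjg n w = w" if n: "n \<in> M" for n
    proof -
      have c: "n \<in> carrier G" "w \<in> carrier G" using n w by auto
      have cn: "conjg g n \<otimes> g = g \<otimes> n" using g c by (simp add: conjg_def m_assoc)
      have "g \<otimes> w \<otimes> n = (b ^^ l) (g \<otimes> n)" using Al(5)[OF g c(1)] \<beta>l[OF n] blg by simp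
      also have "\<dots> = conjg g n \<otimes> (g \<otimes> w)"
        using left_pow[OF conjgM[OF g n], of l] \<kappa>l[OF conjgM[OF g n]] cn blg by simp
      also have "\<dots> = g \<otimes> n \<otimes> w" using cn g c by (simp flip: m_assoc)
      finally have "w \<otimes> n = n \<otimes> w" using g c by (simp add: m_assoc)
      then show ?thesis using c by (simp add: conjg_eq_self_iff)
    qed
    then have "w \<in> Z" using w by (simp add: Z_def)
    then show ?thesis using Z blg g by simp
  qed
  ultimately show ?thesis by blast
qed

end

section \<open>Passage to quotients and the induction on |N|\<close>

lemma funpow_image:
  fixes f :: "'c \<Rightarrow> 'c"
  shows "((`) f ^^ n) S = (f ^^ n) ` S"
  by (induction n) (simp_all add: image_image comp_def)

context group
begin

text \<open>Elements of \<open>G Mod N\<close> are right cosets, whereas displacements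
  \<open>inv g \<otimes> b g\<close> describe left ones; normality identifies the two.\<close>

lemma normal_coset_eq_iff:
  assumes N: "N \<lhd> G" and gh: "g \<in> carrier G" "h \<in> carrier G"
  shows "N #> g = N #> h \<longleftrightarrow> inv g \<otimes> h \<in> N"
proof -
  interpret N: normal N G by (rule N)
  have "N #> g = N #> h \<longleftrightarrow> h \<in> N #> g"
    using repr_independence[OF _ gh(1) N.subgroup_axioms, of h] repr_independenceD[OF N.subgroup_axioms gh(2), of g] by blast
  also have "\<dots> \<longleftrightarrow> h \<in> g <# N" using N.coset_eq gh by simp
  also have "\<dots> \<longleftrightarrow> inv g \<otimes> h \<in> N"
  proof
    assume "h \<in> g <# N"
    then obtain n where n: "n \<in> N" "h = g \<otimes> n" by (auto simp: l_coset_def)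
    then have "inv g \<otimes> h = n" using gh by (simp flip: m_assoc)
    then show "inv g \<otimes> h \<in> N" using n by simp
  next
    assume *: "inv g \<otimes> h \<in> N"
    have "g \<otimes> (inv g \<otimes> h) = h" using gh by (simp flip: m_assoc)
    then show "h \<in> g <# N" using * unfolding l_coset_def by force
  qed
  finally show ?thesis .
qed

lemma affine_with_image_coset:
  assumes b: "affine_with b \<beta>" and N: "N \<lhd> G" and \<beta>N: "\<beta> ` N = N" and g: "g \<in> carrier G"
  shows "b ` (N #> g) = N #> b g"
proof -
  interpret N: normal N G by (rule N)
  note A = affine_withD[OF b]
  have "b ` (g <# N) = (\<lambda>n. b (g \<otimes> n)) ` N" by (auto simp: l_coset_def)
  also have "\<dots> = (\<lambda>n. b g \<otimes> \<beta> n) ` N" by (rule image_cong) (use A(5)[OF g] in simp_all)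
  also have "\<dots> = (\<lambda>n. b g \<otimes> n) ` \<beta> ` N" by (simp only: image_image)
  also have "\<dots> = b g <# N" unfolding \<beta>N by (auto simp: l_coset_def)
  finally show ?thesis using N.coset_eq g A(3)[OF g] by simp
qed

lemma affine_with_linear: "affine_with b \<beta> \<Longrightarrow> affine_with \<beta> \<beta>"
  by (auto simp: affine_with_def hom_def)

lemma affine_with_quotient:
  assumes b: "affine_with b \<beta>" and N: "N \<lhd> G" and \<beta>N: "\<beta> ` N = N"
  shows "group.affine_with (G Mod N) ((`) b) ((`) \<beta>)"
proof -
  interpret N: normal N G by (rule N)
  interpret Q: group "G Mod N" by (rule N.factorgroup_is_group)
  note A = affine_withD[OF b]
  note coset = affine_with_image_coset[OF b N \<beta>N] affine_with_image_coset[OF affine_with_linear[OF b] N \<beta>N]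
  interpret \<beta>: group_hom G G \<beta> using A(1) by unfold_locales
  have car: "\<exists>g\<in>carrier G. C = N #> g" if "C \<in> carrier (G Mod N)" for C
    using that by (auto simp: carrier_FactGroup)
  have mem: "N #> g \<in> carrier (G Mod N)" if "g \<in> carrier G" for g using that by (auto simp: carrier_FactGroup)
  show ?thesis
    unfolding Q.affine_with_def
  proof (intro conjI ballI homI inj_onI)
    fix C D assume C: "C \<in> carrier (G Mod N)" and D: "D \<in> carrier (G Mod N)"
    then obtain g h where g: "g \<in> carrier G" "C = N #> g" and h: "h \<in> carrier G" "D = N #> h" using car by metis
    have CD: "C \<otimes>\<^bsub>G Mod N\<^esub> D = N #> (g \<otimes> h)" using g h by (simp add: N.rcos_sum)
    note cl = A(3)[OF g(1)] A(4)[OF g(1)] A(4)[OF h(1)]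
    show "b ` (C \<otimes>\<^bsub>G Mod N\<^esub> D) = b ` C \<otimes>\<^bsub>G Mod N\<^esub> \<beta> ` D"
      unfolding CD using g h A(5)[OF g(1) h(1)] cl by (simp add: coset N.rcos_sum)
    show "\<beta> ` (C \<otimes>\<^bsub>G Mod N\<^esub> D) = \<beta> ` C \<otimes>\<^bsub>G Mod N\<^esub> \<beta> ` D"
      unfolding CD using g h A(6)[OF g(1) h(1)] cl by (simp add: coset N.rcos_sum)
    assume "\<beta> ` C = \<beta> ` D"
    then have "N #> \<beta> g = N #> \<beta> h" using g h coset(2) by simp
    then have "inv (\<beta> g) \<otimes> \<beta> h \<in> N" using normal_coset_eq_iff[OF N A(4)[OF g(1)] A(4)[OF h(1)]] by simp
    \<comment> \<open>Here N must be equal to its image under \<beta>, not merely contain it: this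
      makes the induced map on cosets injective.\<close>
    then have "\<beta> (inv g \<otimes> h) \<in> \<beta> ` N" unfolding \<beta>N using g h by simp
    then have "inv g \<otimes> h \<in> N"
      by (rule iffD1[OF inj_on_image_mem_iff[OF A(2) _ N.subset], rotated]) (use g(1) h(1) in simp)
    then show "C = D" using normal_coset_eq_iff[OF N g(1) h(1)] g h by simp
  next
    fix C assume "C \<in> carrier (G Mod N)"
    then obtain g where g: "g \<in> carrier G" "C = N #> g" using car by metis
    show "b ` C \<in> carrier (G Mod N)" "\<beta> ` C \<in> carrier (G Mod N)"
      unfolding g(2) coset[OF g(1)] using A(3,4)[OF g(1)] mem by simp_all
  qed
qed

lemma card_quotient:
  assumes N: "subgroup N G" and K: "subgroup K G" "K \<subseteq> N"
  shows "card ((\<lambda>n. K #> n) ` N) * card K = card N"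
proof -
  interpret S: group "G\<lparr>carrier := N\<rparr>" using N by (rule subgroup_imp_group)
  have "subgroup K (G\<lparr>carrier := N\<rparr>)" using K N subgroup_incl by blast
  then have "card (rcosets\<^bsub>G\<lparr>carrier := N\<rparr>\<^esub> K) * card K = order (G\<lparr>carrier := N\<rparr>)" by (rule S.lagrange)
  moreover have "rcosets\<^bsub>G\<lparr>carrier := N\<rparr>\<^esub> K = (\<lambda>n. K #> n) ` N" by (auto simp: RCOSETS_def r_coset_def)
  ultimately show ?thesis by (simp add: order_def)
qed

lemma period_le_card_minimal:
  assumes "finite (carrier G)" and "affine_with b \<beta>" and "M \<lhd> G"
    and "\<And>g. g \<in> carrier G \<Longrightarrow> inv g \<otimes> b g \<in> M"
    and "\<And>Q. \<lbrakk>Q \<lhd> G; Q \<subseteq> M; \<beta> ` Q \<subseteq> Q\<rbrakk> \<Longrightarrow> Q = {\<one>} \<or> Q = M"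
  shows "\<exists>l. 0 < l \<and> l \<le> card M \<and> (\<forall>g\<in>carrier G. (b ^^ l) g = g)"
proof (cases "\<forall>x\<in>M. \<forall>y\<in>M. x \<otimes> y = y \<otimes> x")
  case True
  then show ?thesis by (intro period_le_card_abelian[OF assms]) auto
next
  case False
  then obtain u v where "u \<in> M" "v \<in> M" "u \<otimes> v \<noteq> v \<otimes> u" by blast
  then show ?thesis by (intro period_le_card_nonabelian[OF assms])
qed

text \<open>The induction lets b and \<beta> vary because it is applied to powers: if b has period l
  \<le> |N/K| modulo K, then b^l preserves the cosets of K and has a period k \<le> |K|, so l k is a
  period of b.\<close>

theorem period_le_card:
  assumes fin: "finite (carrier G)"
  shows "\<lbrakk>affine_with b \<beta>; N \<lhd> G; \<forall>g\<in>carrier G. inv g \<otimes> b g \<in> N\<rbrakk>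
    \<Longrightarrow> \<exists>l. 0 < l \<and> l \<le> card N \<and> (\<forall>g\<in>carrier G. (b ^^ l) g = g)"
proof (induction "card N" arbitrary: N b \<beta> rule: less_induct)
  case less
  note b = less.prems(1) and N = less.prems(2)
  have triv: "inv g \<otimes> b g \<in> N" if "g \<in> carrier G" for g using less.prems(3) that by blast
  interpret N: normal N G by (rule N)
  note A = affine_withD[OF b]
  have sN: "subgroup N G" by (rule N.subgroup_axioms)
  have finN: "finite N" using N.subset fin by (rule finite_subset)
  have cardN: "card N > 0" using finN subgroup.one_closed[OF sN] card_gt_0_iff by blast
  show ?case
  proof (cases "N = {\<one>}")
    case True
    have "b g = g" if g: "g \<in> carrier G" for g
    proof -
      have "inv g \<otimes> b g = \<one>" using triv[OF g] True by blast
      then have "g \<otimes> (inv g \<otimes> b g) = g" using g by simp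
      then show ?thesis using g A(3)[OF g] by (simp flip: m_assoc)
    qed
    then show ?thesis using cardN by (intro exI[of _ 1]) simp
  next
    case False
    \<comment> \<open>A maximal member K of S makes N/K minimal among the normal subgroups of G/K
      that are invariant under the induced linear part.\<close>
    define S where "S = {K. K \<lhd> G \<and> K \<subset> N \<and> \<beta> ` K \<subseteq> K}"
    interpret \<beta>: group_hom G G \<beta> using A(1) by unfold_locales
    have "{\<one>} \<in> S" unfolding S_def using False subgroup.one_closed[OF sN] one_is_normal by auto
    moreover have "finite S" by (rule finite_subset[of _ "Pow N"]) (use finN in \<open>auto simp: S_def\<close>)
    ultimately obtain K where K: "K \<in> S" and K_max: "\<And>L. \<lbrakk>L \<in> S; K \<subseteq> L\<rbrakk> \<Longrightarrow> K = L"
      using finite_has_maximal[of S] by blast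
    have KG: "K \<lhd> G" and KN: "K \<subset> N" and \<beta>K_sub: "\<beta> ` K \<subseteq> K" using K by (auto simp: S_def)
    interpret K: normal K G by (rule KG)
    have sK: "subgroup K G" by (rule K.subgroup_axioms)
    have finK: "finite K" using KN finN finite_subset by blast
    have \<beta>K: "\<beta> ` K = K"
      by (rule endo_inj_surj[OF finK \<beta>K_sub]) (rule inj_on_subset[OF A(2) K.subset])
    interpret Q: group "G Mod K" by (rule K.factorgroup_is_group)
    define M where "M = (\<lambda>n. K #> n) ` N"
    have eq_iff: "K #> g = K #> h \<longleftrightarrow> inv g \<otimes> h \<in> K" if "g \<in> carrier G" "h \<in> carrier G" for g h
      using normal_coset_eq_iff[OF KG that] .
    have mem_M: "K #> g \<in> M \<longleftrightarrow> g \<in> N" if g: "g \<in> carrier G" for g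
    proof
      assume "K #> g \<in> M"
      then obtain n where n: "n \<in> N" "K #> n = K #> g" by (auto simp: M_def)
      have nc: "n \<in> carrier G" using n(1) by simp
      have "inv n \<otimes> g \<in> N" using eq_iff[OF nc g] n(2) KN by blast
      then have "n \<otimes> (inv n \<otimes> g) \<in> N" using n(1) sN by (simp add: subgroup.m_closed)
      then show "g \<in> N" using nc g by (simp flip: m_assoc)
    qed (auto simp: M_def)
    have car: "carrier (G Mod K) = (\<lambda>g. K #> g) ` carrier G" by (rule carrier_FactGroup)
    have mult: "(K #> g) \<otimes>\<^bsub>G Mod K\<^esub> (K #> h) = K #> (g \<otimes> h)" if "g \<in> carrier G" "h \<in> carrier G" for g h
      using that by (simp add: K.rcos_sum)
    have inv: "inv\<^bsub>G Mod K\<^esub> (K #> g) = K #> inv g" if "g \<in> carrier G" for g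
      using that K.inv_FactGroup[of "K #> g"] K.rcos_inv by (auto simp: car)
    have M: "M \<lhd> G Mod K"
      unfolding Q.normal_inv_iff
    proof (intro conjI ballI)
      show "subgroup M (G Mod K)"
      proof (rule Q.subgroupI)
        show "M \<subseteq> carrier (G Mod K)" unfolding M_def car using N.subset by blast
        show "M \<noteq> {}" unfolding M_def using subgroup.one_closed[OF sN] by blast
      next
        fix C assume "C \<in> M"
        then obtain n where "n \<in> N" "C = K #> n" by (auto simp: M_def)
        then show "inv\<^bsub>G Mod K\<^esub> C \<in> M" by (simp add: inv mem_M)
      next
        fix C D assume "C \<in> M" "D \<in> M"
        then obtain n k where "n \<in> N" "C = K #> n" "k \<in> N" "D = K #> k" by (auto simp: M_def)
        then show "C \<otimes>\<^bsub>G Mod K\<^esub> D \<in> M" using mult[of n k] by (simp add: mem_M)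
      qed
    next
      fix C D assume "C \<in> carrier (G Mod K)" "D \<in> M"
      then obtain g n where gn: "g \<in> carrier G" "C = K #> g" "n \<in> N" "D = K #> n" by (auto simp: M_def car)
      then have "C \<otimes>\<^bsub>G Mod K\<^esub> D \<otimes>\<^bsub>G Mod K\<^esub> inv\<^bsub>G Mod K\<^esub> C = K #> (g \<otimes> n \<otimes> inv g)"
        using mult inv by simp
      then show "C \<otimes>\<^bsub>G Mod K\<^esub> D \<otimes>\<^bsub>G Mod K\<^esub> inv\<^bsub>G Mod K\<^esub> C \<in> M"
        using N.inv_op_closed2[OF gn(1,3)] gn by (simp add: mem_M)
    qed
    have bQ: "Q.affine_with ((`) b) ((`) \<beta>)" by (rule affine_with_quotient[OF b KG \<beta>K])
    have coset: "b ` (K #> g) = K #> b g" "\<beta> ` (K #> g) = K #> \<beta> g" if "g \<in> carrier G" for g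
      using affine_with_image_coset[OF b KG \<beta>K that] affine_with_image_coset[OF affine_with_linear[OF b] KG \<beta>K that] .
    have "\<exists>l. 0 < l \<and> l \<le> card M \<and> (\<forall>C\<in>carrier (G Mod K). ((`) b ^^ l) C = C)"
    proof (rule Q.period_le_card_minimal[OF _ bQ M])
      show "finite (carrier (G Mod K))" unfolding car using fin by simp
      fix C assume "C \<in> carrier (G Mod K)"
      then obtain g where g: "g \<in> carrier G" "C = K #> g" by (auto simp: car)
      then have "inv\<^bsub>G Mod K\<^esub> C \<otimes>\<^bsub>G Mod K\<^esub> b ` C = K #> (inv g \<otimes> b g)"
        using mult[of "inv g" "b g"] inv coset A(3) by simp
      then show "inv\<^bsub>G Mod K\<^esub> C \<otimes>\<^bsub>G Mod K\<^esub> b ` C \<in> M" using g triv A(3) by (simp add: mem_M)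
    next
      fix R assume R: "R \<lhd> G Mod K" "R \<subseteq> M" "(`) \<beta> ` R \<subseteq> R"
      interpret R: normal R "G Mod K" by (rule R(1))
      have sR: "subgroup R (G Mod K)" by (rule R.subgroup_axioms)
      \<comment> \<open>The full preimage of R lies between K and N. If it is not N, it belongs to
        S, and maximality of K collapses it to K.\<close>
      define L where "L = {g \<in> carrier G. K #> g \<in> R}"
      have one: "K \<in> R" using subgroup.one_closed[OF sR] by simp
      have KL: "K \<subseteq> L"
        using one K.rcos_const[OF is_group] by (auto simp: L_def)
      have LN: "L \<subseteq> N" using R(2) mem_M by (auto simp: L_def)
      have "subgroup L G"
      proof (rule subgroupI)
        show "L \<noteq> {}" using KL subgroup.one_closed[OF sK] by blast
      next
        fix a assume "a \<in> L"
        then show "inv a \<in> L" using subgroup.m_inv_closed[OF sR, of "K #> a"] inv[of a] by (simp add: L_def)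
      next
        fix a c assume "a \<in> L" "c \<in> L"
        then show "a \<otimes> c \<in> L" using subgroup.m_closed[OF sR, of "K #> a" "K #> c"] mult[of a c] by (simp add: L_def)
      qed (auto simp: L_def)
      moreover have "g \<otimes> h \<otimes> inv g \<in> L" if "g \<in> carrier G" "h \<in> L" for g h
        using R.inv_op_closed2[of "K #> g" "K #> h"] that mult inv by (simp add: L_def car)
      ultimately have LG: "L \<lhd> G" unfolding normal_inv_iff by blast
      have \<beta>L: "\<beta> ` L \<subseteq> L" using R(3) coset(2) A(4) by (auto simp: L_def image_subset_iff)
      have R_eq: "R = (\<lambda>g. K #> g) ` L" using R(2) N.subset by (auto simp: L_def M_def)
      show "R = {\<one>\<^bsub>G Mod K\<^esub>} \<or> R = M"
      proof (cases "L = N")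
        case True
        then show ?thesis using R_eq by (simp add: M_def)
      next
        case False
        then have "L \<in> S" using LG LN \<beta>L by (auto simp: S_def)
        then have "L = K" using K_max KL by blast
        then have "R \<subseteq> {K}" using R_eq K.rcos_const[OF is_group] by auto
        then show ?thesis using one by auto
      qed
    qed
    then obtain l where l: "0 < l" "l \<le> card M" "\<And>C. C \<in> carrier (G Mod K) \<Longrightarrow> ((`) b ^^ l) C = C" by blast
    note Al = affine_withD[OF affine_with_funpow[OF b, of l]]
    have "((`) \<beta> ^^ l) K = K" by (induction l) (simp_all add: \<beta>K)
    then have \<beta>l: "(\<beta> ^^ l) ` K = K" by (simp only: funpow_image)
    \<comment> \<open>That b^l fixes every coset of K is the hypothesis of the induction for b^l and
      K.\<close>
    have "inv g \<otimes> (b ^^ l) g \<in> K" if g: "g \<in> carrier G" for g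
    proof -
      have "K #> g = (b ^^ l) ` (K #> g)" using l(3)[of "K #> g"] g by (simp add: car funpow_image)
      also have "\<dots> = K #> (b ^^ l) g" by (rule affine_with_image_coset[OF affine_with_funpow[OF b] KG \<beta>l g])
      finally show ?thesis using eq_iff[OF g Al(3)[OF g]] by simp
    qed
    moreover have "card K < card N" using KN finN by (rule psubset_card_mono[rotated])
    ultimately obtain k where k: "0 < k" "k \<le> card K" "\<forall>g\<in>carrier G. ((b ^^ l) ^^ k) g = g"
      using less.hyps[OF _ affine_with_funpow[OF b] KG] by blast
    have "l * k \<le> card M * card K" using l k by (intro mult_le_mono)
    also have "card M * card K = card N" unfolding M_def by (rule card_quotient) (use sN sK KN in auto)
    finally have "l * k \<le> card N" .
    then show ?thesis using l(1) k by (intro exI[of _ "l * k"]) (simp add: funpow_mult mult.commute)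
  qed
qed

section \<open>Comparison with the quotient\<close>

text \<open>Automorphisms become affine maps with translation part 1, so that a single comparison
  with the quotient serves both \<open>mao\<close> and \<open>maffo\<close>.\<close>

lemma affine_map_one:
  assumes "\<alpha> \<in> auto G"
  shows "affine_map G \<one> \<alpha> = \<alpha>"
proof (rule extensionalityI[of _ "carrier G"])
  show "\<alpha> \<in> extensional (carrier G)" using assms by (simp add: auto_def Bij_def)
  fix g assume "g \<in> carrier G"
  moreover from this have "\<alpha> g \<in> carrier G" using assms by (auto simp: auto_def hom_def)
  ultimately show "affine_map G \<one> \<alpha> g = \<alpha> g" by (simp add: affine_map_def)
qed (simp add: affine_map_def)

lemma characteristic_imp_normal:
  assumes "characteristic_subgroup N G"
  shows "N \<lhd> G"
  unfolding normal_conjg_iff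
proof (intro conjI ballI)
  show N: "subgroup N G" using assms by (simp add: characteristic_subgroup_def)
  fix g n assume g: "g \<in> carrier G" and n: "n \<in> N"
  have "restrict (conjg g) (carrier G) ` N = N"
    using assms inner_in_auto[OF g] unfolding characteristic_subgroup_def by blast
  then have "restrict (conjg g) (carrier G) n \<in> N" using n by blast
  then show "conjg g n \<in> N" using subgroup.subset[OF N] n by (simp add: subset_iff)
qed

text \<open>The translation part on the quotient is kept visible as N #> x: for x = 1 it is the
  identity coset, so automorphisms are compared with automorphisms. The invariance of N under
  \<alpha> is what provides \<alpha>'.\<close>

lemma ord_affine_map_le:
  assumes fin: "finite (carrier G)" and N: "N \<lhd> G" and \<alpha>: "\<alpha> \<in> auto G" "\<alpha> ` N = N" and x: "x \<in> carrier G"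
  obtains \<alpha>' where "\<alpha>' \<in> auto (G Mod N)"
    and "group.ord (BijGroup (carrier G)) (affine_map G x \<alpha>)
      \<le> group.ord (BijGroup (carrier (G Mod N))) (affine_map (G Mod N) (N #> x) \<alpha>') * card N"
proof -
  interpret N: normal N G by (rule N)
  interpret Q: group "G Mod N" by (rule N.factorgroup_is_group)
  let ?Q = "carrier (G Mod N)"
  define b where "b = (\<lambda>g. x \<otimes> \<alpha> g)"
  have \<alpha>_hom: "\<alpha> \<in> hom G G" and \<alpha>_inj: "inj_on \<alpha> (carrier G)"
    using \<alpha>(1) by (auto simp: auto_def Bij_def bij_betw_def)
  interpret \<alpha>: group_hom G G \<alpha> using \<alpha>_hom by unfold_locales
  have b: "affine_with b \<alpha>"
    unfolding affine_with_def using \<alpha>_hom \<alpha>_inj x by (auto simp: b_def m_assoc)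
  have finQ: "finite ?Q" unfolding carrier_FactGroup using fin by simp
  define \<alpha>' where "\<alpha>' = restrict ((`) \<alpha>) ?Q"
  note bQ = affine_with_quotient[OF b N \<alpha>(2)]
  note B = Q.affine_withD[OF bQ] and A = Q.affine_withD[OF Q.affine_with_linear[OF bQ]]
  have "(`) \<alpha> ` ?Q \<subseteq> ?Q" using A(3) by (rule image_subsetI)
  then have "\<alpha>' \<in> Bij ?Q" unfolding \<alpha>'_def using finQ A(2) by (intro ord_restrict(1))
  moreover have "\<alpha>' \<in> hom (G Mod N) (G Mod N)"
    unfolding \<alpha>'_def by (rule homI) (use A(3,6) Q.m_closed in simp_all)
  ultimately have auto: "\<alpha>' \<in> auto (G Mod N)" by (simp add: auto_def)
  have "affine_map (G Mod N) (N #> x) \<alpha>' = restrict ((`) b) ?Q"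
    unfolding affine_map_def
  proof (rule restrict_ext)
    fix C assume C: "C \<in> ?Q"
    then obtain g where g: "g \<in> carrier G" "C = N #> g" by (auto simp: carrier_FactGroup)
    have "\<alpha>' C = N #> \<alpha> g" using C g affine_with_image_coset[OF affine_with_linear[OF b] N \<alpha>(2) g(1)] by (simp add: \<alpha>'_def)
    moreover have "b ` C = N #> b g" unfolding g(2) by (rule affine_with_image_coset[OF b N \<alpha>(2) g(1)])
    ultimately show "(N #> x) \<otimes>\<^bsub>G Mod N\<^esub> \<alpha>' C = b ` C" using x g by (simp add: b_def N.rcos_sum)
  qed
  moreover have bQQ: "(`) b ` ?Q \<subseteq> ?Q" using B(3) by (rule image_subsetI)
  moreover have injQ: "inj_on ((`) b) ?Q"
  proof (rule inj_onI)
    fix C D assume C: "C \<in> ?Q" and D: "D \<in> ?Q" and eq: "b ` C = b ` D"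
    have "inj_on b (carrier G)"
    proof (rule inj_onI)
      fix g h assume g: "g \<in> carrier G" and h: "h \<in> carrier G" and "b g = b h"
      then have "\<alpha> g = \<alpha> h" using x by (simp add: b_def)
      then show "g = h" using \<alpha>_inj g h by (simp add: inj_on_eq_iff)
    qed
    moreover have "C \<subseteq> carrier G" "D \<subseteq> carrier G"
      using C D r_coset_subset_G[OF N.subset] by (auto simp: carrier_FactGroup)
    ultimately show "C = D" using eq inj_on_image_eq_iff by blast
  qed
  define L where "L = group.ord (BijGroup ?Q) (affine_map (G Mod N) (N #> x) \<alpha>')"
  ultimately have L0: "L > 0" and L: "\<And>C. C \<in> ?Q \<Longrightarrow> ((`) b ^^ L) C = C"
    using ord_restrict(2)[OF finQ bQQ injQ] ord_restrict(3)[OF finQ bQQ injQ, of L] by simp_all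
  note BL = affine_withD[OF affine_with_funpow[OF b, of L]]
  \<comment> \<open>By the choice of L, the power b^L induces the identity on G/N, so
    \<open>period_le_card\<close> applies to it and gives a further factor of at most |N|.\<close>
  have "\<forall>g\<in>carrier G. inv g \<otimes> (b ^^ L) g \<in> N"
  proof
    fix g assume g: "g \<in> carrier G"
    have "((`) \<alpha> ^^ L) N = N" by (induction L) (simp_all add: \<alpha>(2))
    then have \<alpha>L: "(\<alpha> ^^ L) ` N = N" by (simp only: funpow_image)
    have "N #> g = (b ^^ L) ` (N #> g)" using L[of "N #> g"] g by (simp add: carrier_FactGroup funpow_image)
    also have "\<dots> = N #> (b ^^ L) g" by (rule affine_with_image_coset[OF affine_with_funpow[OF b] N \<alpha>L g])
    finally show "inv g \<otimes> (b ^^ L) g \<in> N" using normal_coset_eq_iff[OF N g BL(3)[OF g]] by simp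
  qed
  then obtain l where l: "0 < l" "l \<le> card N" "\<forall>g\<in>carrier G. ((b ^^ L) ^^ l) g = g"
    using period_le_card[OF fin affine_with_funpow[OF b] N] by blast
  have Bij: "affine_map G x \<alpha> \<in> Bij (carrier G)" using affine_map_in_Bij[OF x \<alpha>(1)] by (simp add: BijGroup_def)
  have "affine_map G x \<alpha> = restrict b (carrier G)" by (simp add: affine_map_def b_def)
  moreover have "b ` carrier G \<subseteq> carrier G" using affine_withD(3)[OF b] by blast
  ultimately have "\<forall>g\<in>carrier G. (affine_map G x \<alpha> ^^ (L * l)) g = g"
    using l(3) by (simp add: funpow_restrict funpow_mult mult.commute)
  then have "group.ord (BijGroup (carrier G)) (affine_map G x \<alpha>) dvd L * l"
    using BijGroup_ord_dvd_iff[OF Bij] by blast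
  then have "group.ord (BijGroup (carrier G)) (affine_map G x \<alpha>) \<le> L * l" using L0 l(1) by (intro dvd_imp_le) simp_all
  also have "\<dots> \<le> L * card N" using l(2) by simp
  finally show ?thesis using auto that unfolding L_def by blast
qed

lemma finite_auto: "finite (carrier G) \<Longrightarrow> finite (auto G)"
  using finite_Bij by (rule finite_subset[rotated]) (auto simp: auto_def)

lemma mao_attained:
  assumes "finite (carrier G)"
  obtains \<alpha> where "\<alpha> \<in> auto G" "mao G = group.ord (BijGroup (carrier G)) (affine_map G \<one> \<alpha>)"
proof -
  have "{group.ord (AutoGroup G) \<alpha> | \<alpha>. \<alpha> \<in> auto G} = group.ord (AutoGroup G) ` auto G" by blast
  moreover have "auto G \<noteq> {}" using id_in_auto by blast
  ultimately have "mao G \<in> group.ord (AutoGroup G) ` auto G"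
    unfolding mao_def using finite_auto[OF assms] by (simp add: Max_in)
  then show ?thesis using that by (auto simp: ord_AutoGroup affine_map_one)
qed

lemma ord_le_mao:
  assumes "finite (carrier G)" "\<alpha> \<in> auto G"
  shows "group.ord (BijGroup (carrier G)) (affine_map G \<one> \<alpha>) \<le> mao G"
proof -
  have "{group.ord (AutoGroup G) \<alpha> | \<alpha>. \<alpha> \<in> auto G} = group.ord (AutoGroup G) ` auto G" by blast
  then show ?thesis
    unfolding mao_def using finite_auto[OF assms(1)] assms(2)
    by (simp add: affine_map_one flip: ord_AutoGroup)
qed

lemma maffo_image:
  "maffo G = Max ((\<lambda>(x, \<alpha>). group.ord (BijGroup (carrier G)) (affine_map G x \<alpha>)) ` (carrier G \<times> auto G))"
  unfolding maffo_def by (rule arg_cong[of _ _ Max]) auto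

lemma maffo_attained:
  assumes "finite (carrier G)"
  obtains x \<alpha> where "x \<in> carrier G" "\<alpha> \<in> auto G"
    "maffo G = group.ord (BijGroup (carrier G)) (affine_map G x \<alpha>)"
proof -
  let ?f = "\<lambda>(x, \<alpha>). group.ord (BijGroup (carrier G)) (affine_map G x \<alpha>)"
  have "carrier G \<times> auto G \<noteq> {}" using id_in_auto by blast
  then have "maffo G \<in> ?f ` (carrier G \<times> auto G)"
    unfolding maffo_image using finite_auto[OF assms] assms by (intro Max_in) auto
  then show ?thesis using that by auto
qed

lemma ord_le_maffo:
  assumes "finite (carrier G)" "x \<in> carrier G" "\<alpha> \<in> auto G"
  shows "group.ord (BijGroup (carrier G)) (affine_map G x \<alpha>) \<le> maffo G"
  unfolding maffo_image using finite_auto[OF assms(1)] assms by (intro Max_ge) auto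

end

theorem corollary1p1p4:
  fixes G :: "('a, 'b) monoid_scheme" and N :: "'a set"
  assumes "group G" and "finite (carrier G)" and "characteristic_subgroup N G"
  shows "mao_rel (G Mod N) \<ge> mao_rel G \<and> maffo_rel (G Mod N) \<ge> maffo_rel G"
proof -
  interpret group G by (rule assms(1))
  note fin = assms(2)
  have N: "N \<lhd> G" using assms(3) by (rule characteristic_imp_normal)
  interpret N: normal N G by (rule N)
  interpret Q: group "G Mod N" by (rule N.factorgroup_is_group)
  have inv: "\<alpha> ` N = N" if "\<alpha> \<in> auto G" for \<alpha> using assms(3) that by (simp add: characteristic_subgroup_def)
  have finQ: "finite (carrier (G Mod N))" unfolding carrier_FactGroup using fin by simp
  have order: "order (G Mod N) * card N = order G"
    using lagrange[OF N.subgroup_axioms] by (simp add: order_def FactGroup_def)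
  have "order G > 0" using fin by (simp add: order_gt_0_iff_finite)
  then have pos: "order (G Mod N) > 0" "card N > 0" using order by (auto intro: gr0I)
  \<comment> \<open>Dividing m \<le> k |N| by |G| = |G/N| |N| cancels |N|, which is exactly the
    passage to relative orders.\<close>
  have rel: "real m / real (order G) \<le> real k / real (order (G Mod N))" if "m \<le> k * card N" for m k
  proof -
    have "real m \<le> real k * real (card N)" using that by (metis of_nat_le_iff of_nat_mult)
    then show ?thesis using pos unfolding order[symmetric] by (simp add: field_simps)
  qed
  obtain \<alpha> where \<alpha>: "\<alpha> \<in> auto G" "mao G = group.ord (BijGroup (carrier G)) (affine_map G \<one>\<^bsub>G\<^esub> \<alpha>)"
    using mao_attained[OF fin] .
  obtain \<alpha>' where \<alpha>': "\<alpha>' \<in> auto (G Mod N)"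
    "mao G \<le> group.ord (BijGroup (carrier (G Mod N))) (affine_map (G Mod N) (N #>\<^bsub>G\<^esub> \<one>\<^bsub>G\<^esub>) \<alpha>') * card N"
    using ord_affine_map_le[OF fin N \<alpha>(1) inv[OF \<alpha>(1)] one_closed] unfolding \<alpha>(2) .
  \<comment> \<open>With translation part 1 on the quotient, the affine map there is an automorphism
    and its order is bounded by \<open>mao\<close>.\<close>
  have "N #>\<^bsub>G\<^esub> \<one>\<^bsub>G\<^esub> = \<one>\<^bsub>G Mod N\<^esub>" using N.subset by (simp add: coset_mult_one)
  then have "mao G \<le> mao (G Mod N) * card N"
    using \<alpha>'(2) Q.ord_le_mao[OF finQ \<alpha>'(1)] by (metis mult_le_mono1 order_trans)
  moreover obtain x \<beta> where x: "x \<in> carrier G" "\<beta> \<in> auto G"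
    "maffo G = group.ord (BijGroup (carrier G)) (affine_map G x \<beta>)"
    using maffo_attained[OF fin] .
  obtain \<beta>' where \<beta>': "\<beta>' \<in> auto (G Mod N)"
    "maffo G \<le> group.ord (BijGroup (carrier (G Mod N))) (affine_map (G Mod N) (N #>\<^bsub>G\<^esub> x) \<beta>') * card N"
    using ord_affine_map_le[OF fin N x(2) inv[OF x(2)] x(1)] unfolding x(3) .
  have "N #>\<^bsub>G\<^esub> x \<in> carrier (G Mod N)" using x(1) by (simp add: carrier_FactGroup)
  then have "maffo G \<le> maffo (G Mod N) * card N"
    using \<beta>'(2) Q.ord_le_maffo[OF finQ _ \<beta>'(1)] by (meson mult_le_mono1 order_trans)
  ultimately show ?thesis unfolding mao_rel_def maffo_rel_def using rel by blast
qed

end
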